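(* The number $N_{\mathcal D}(T)$ of integer Descartes quadruples of Euclidean height at most $T$ satisfies $N_{\mathcal D}(T)=N_{\mathcal L}(T)$, and $$N_{\mathcal L}(T)=\frac{\pi^2}{4L(2,\chi_{-4})}\,T^2+O\big(T(\log T)^2\big)\quad\text{as } T\to\infty,$$ where $L(2,\chi_{-4})=\sum_{n=0}^{\infty}\frac{(-1)^n}{(2n+1)^2}\approx 0.9159$. The number $N_{\mathcal D}^*(T)$ of primitive integer Descartes quadruples of Euclidean height at most $T$ satisfies $N_{\mathcal D}^*(T)=N_{\mathcal L}^*(T)$, and $$N_{\mathcal L}^*(T)=\frac{3}{2L(2,\chi_{-4})}\,T^2+O\big(T(\log T)^2\big)\quad\text{as } T\to\infty.$$
   Context: An integer Descartes quadruple is $(a,b,c,d)\in\mathbb Z^4$ with $2(a^2+b^2+c^2+d^2)=(a+b+c+d)^2$. An integer Lorentz quadruple is $(W,X,Y,Z)\in\mathbb Z^4$ with $-W^2+X^2+Y^2+Z^2=0$. Such a quadruple is primitive if the gcd of its four entries is $1$. The Euclidean height of $\mathbf a=(a,b,c,d)\in\mathbb R^4$ is $H(\mathbf a)=(a^2+b^2+c^2+d^2)^{1/2}$. $N_{\mathcal D}(T)$ and $N_{\mathcal L}(T)$ denote the numbers of integer Descartes quadruples, respectively integer Lorentz quadruples, of Euclidean height at most $T$; $N_{\mathcal D}^*(T)$ and $N_{\mathcal L}^*(T)$ denote the corresponding numbers of primitive ones. Quadruples are ordered and entries may be of any sign. *)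

theory Defs
  imports "HOL-Analysis.Analysis" "HOL-Library.Landau_Symbols"
begin

type_synonym quadruple = "int \<times> int \<times> int \<times> int"

definition descartes_quadruple :: "quadruple \<Rightarrow> bool" where
  "descartes_quadruple = (\<lambda>(a, b, c, d). 2 * (a^2 + b^2 + c^2 + d^2) = (a + b + c + d)^2)"

definition lorentz_quadruple :: "quadruple \<Rightarrow> bool" where
  "lorentz_quadruple = (\<lambda>(W, X, Y, Z). - (W^2) + X^2 + Y^2 + Z^2 = 0)"

definition primitive_quadruple :: "quadruple \<Rightarrow> bool" where
  "primitive_quadruple = (\<lambda>(a, b, c, d). Gcd {a, b, c, d} = 1)"

definition euclidean_height :: "real \<times> real \<times> real \<times> real \<Rightarrow> real" where
  "euclidean_height = (\<lambda>(a, b, c, d). sqrt (a^2 + b^2 + c^2 + d^2))"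

definition real_quadruple :: "quadruple \<Rightarrow> real \<times> real \<times> real \<times> real" where
  "real_quadruple = (\<lambda>(a, b, c, d). (of_int a, of_int b, of_int c, of_int d))"

text \<open>
  The sets counted below are finite, since only finitely many integer quadruples have height at
  most \<open>T\<close>, so \<open>card\<close> is the true number of elements.
\<close>

definition N_D :: "real \<Rightarrow> nat" where
  "N_D T = card {q. descartes_quadruple q \<and> euclidean_height (real_quadruple q) \<le> T}"

definition N_L :: "real \<Rightarrow> nat" where
  "N_L T = card {q. lorentz_quadruple q \<and> euclidean_height (real_quadruple q) \<le> T}"

definition N_D_prim :: "real \<Rightarrow> nat" where
  "N_D_prim T = card {q. descartes_quadruple q \<and> primitive_quadruple q \<and>
     euclidean_height (real_quadruple q) \<le> T}"

definition N_L_prim :: "real \<Rightarrow> nat" where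
  "N_L_prim T = card {q. lorentz_quadruple q \<and> primitive_quadruple q \<and>
     euclidean_height (real_quadruple q) \<le> T}"

text \<open>The value \<open>L(2, \<chi>)\<close> for the nontrivial Dirichlet character \<open>\<chi>\<close> modulo 4 (Catalan's constant).\<close>

definition L2_chi_minus4 :: real where
  "L2_chi_minus4 = (\<Sum>n. (-1) ^ n / (2 * real n + 1) ^ 2)"

end

theory Submission
  imports Defs "HOL-Computational_Algebra.Squarefree" "HOL-Real_Asymp.Real_Asymp"
begin

text \<open>
  The matrix with rows \<open>(1,1,1,1)/2\<close>, \<open>(1,1,-1,-1)/2\<close>, \<open>(1,-1,1,-1)/2\<close>, \<open>(1,-1,-1,1)/2\<close> is an
  orthogonal involution that exchanges Descartes and Lorentz quadruples and preserves integrality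
  and primitivity, so only Lorentz quadruples have to be counted, and these are counted by \<open>W\<close>.

  Let \<open>\<chi>\<close> be the character modulo 4. For odd \<open>m\<close>, exactly one of the entries of a solution of
  \<open>X\<^sup>2 + Y\<^sup>2 + Z\<^sup>2 = m\<^sup>2\<close> is odd; if \<open>Z\<close> is even, then \<open>u = m - Z\<close> and \<open>v = m + Z\<close> are odd, and
  \<open>X\<^sup>2 + Y\<^sup>2 = u v\<close> has \<open>4 \<Sum>\<^sub>d\<^sub>|\<^sub>u\<^sub>v \<chi>(d)\<close> solutions. This number is obtained by showing
  that both sides satisfy the same recurrence. Expanding the sum over \<open>d | u v\<close> and using
  Dirichlet's evaluation of \<open>\<Sum> \<chi>(a) \<chi>(b)\<close> over \<open>a a' + b b' = 2 m\<close>, one finds that the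
  number of primitive solutions is \<open>6 m \<Sum>\<^sub>d\<^sub>|\<^sub>m \<mu>(d) \<chi>(d) / d\<close>, and zero for even \<open>m\<close>. Summing over
  \<open>m \<le> T / sqrt 2\<close> gives the primitive count with error \<open>O(T log T)\<close>, since
  \<open>\<Sum> \<mu>(d) \<chi>(d) / d\<^sup>2 = 1 / L(2, \<chi>)\<close>; summing that over the gcd gives the other count.
\<close>

section \<open>The character modulo 4 and a sum over indefinite forms\<close>

definition chi :: "int \<Rightarrow> int" where
  "chi n = (if n mod 4 = 1 then 1 else if n mod 4 = 3 then -1 else 0)"

lemma chi_cong: "m mod 4 = n mod 4 \<Longrightarrow> chi m = chi n"
  by (simp add: chi_def)

lemma mod4_cases:
  fixes n :: int
  obtains "n mod 4 = 0" | "n mod 4 = 1" | "n mod 4 = 2" | "n mod 4 = 3"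
proof -
  have "0 \<le> n mod 4" "n mod 4 < 4" by auto
  then show ?thesis using that by linarith
qed

lemma chi_mult: "chi (m * n) = chi m * chi n"
proof -
  have "m * n mod 4 = (m mod 4) * (n mod 4) mod 4" by (simp add: mod_mult_eq)
  then show ?thesis
    by (cases m rule: mod4_cases; cases n rule: mod4_cases) (simp_all add: chi_def)
qed

lemma chi_1 [simp]: "chi 1 = 1"
  by (simp add: chi_def)

lemma chi_odd_square: "odd n \<Longrightarrow> chi n * chi n = 1"
  by (cases n rule: mod4_cases) (simp_all add: chi_def, presburger+)

lemma abs_chi_le: "\<bar>chi n\<bar> \<le> 1"
  by (simp add: chi_def)

lemma chi_minus_eq: "(m + n) mod 4 = 0 \<Longrightarrow> chi n = - chi m"
  by (cases m rule: mod4_cases; cases n rule: mod4_cases) (simp_all add: chi_def mod_add_eq[symmetric, of m n])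

lemma abs_le_square_int: "\<bar>a\<bar> \<le> (a::int)\<^sup>2"
  using mult_left_mono[of 1 "\<bar>a\<bar>" "\<bar>a\<bar>"] by (cases "a = 0") (auto simp: power2_eq_square)

lemma pos_mult_ge: "0 < a \<Longrightarrow> 0 < b \<Longrightarrow> a \<le> a * (b::int)" "0 < a \<Longrightarrow> 0 < b \<Longrightarrow> b \<le> a * (b::int)"
  using mult_left_mono[of 1 b a] mult_right_mono[of 1 a b] by auto

lemma odd_square_mod8:
  assumes "odd (a::int)" shows "a\<^sup>2 mod 8 = 1"
proof -
  obtain k where k: "a = 2 * k + 1" using assms by (elim oddE)
  have "even (k * (k + 1))" by simp
  then obtain j where j: "k * (k + 1) = 2 * j" by (elim evenE)
  have "a\<^sup>2 = 8 * j + 1" using j unfolding k by (simp add: power2_eq_square algebra_simps)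
  then show ?thesis by simp
qed

text \<open>
  A triple \<open>(a, d, e)\<close> in \<open>river M\<close> stands for the form \<open>d x\<^sup>2 + 2 a x y - 2 e y\<^sup>2\<close> of discriminant
  \<open>4 M\<close>, that is, for an edge of a Conway river that separates a positive odd value from a negative
  even value. Triples in \<open>odd_river M\<close> are the edges \<open>y x\<^sup>2 + 2 b x z - w z\<^sup>2\<close> between values of
  opposite sign that are both odd. The sums below telescope along the rivers.
\<close>

definition river :: "int \<Rightarrow> (int \<times> int \<times> int) set" where
  "river M = {(a, d, e). 0 < d \<and> 0 < e \<and> a\<^sup>2 + 2 * d * e = M}"

definition odd_river :: "int \<Rightarrow> (int \<times> int \<times> int) set" where
  "odd_river M = {(b, y, w). even b \<and> 0 < y \<and> 0 < w \<and> b\<^sup>2 + y * w = M}"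

text \<open>The factor \<open>k\<close> lets one bound serve both families: \<open>k = 2\<close> for
  \<open>river\<close> and \<open>k = 1\<close> for \<open>odd_river\<close>.\<close>

lemma river_bounds:
  assumes "a\<^sup>2 + k * d * e = (M::int)" "0 < d" "0 < e" "0 < k"
  shows "\<bar>a\<bar> \<le> M" "d \<le> M" "e \<le> M"
proof -
  have p: "0 < d * e" "d \<le> d * e" "e \<le> d * e" "d * e \<le> k * (d * e)"
    using assms(2-4) pos_mult_ge[of d e] pos_mult_ge(2)[of k "d * e"] by simp_all
  show "\<bar>a\<bar> \<le> M" "d \<le> M" "e \<le> M" using p assms(1) zero_le_power2[of a] abs_le_square_int[of a] by (auto simp: mult.assoc)
qed

lemma finite_river: "finite (river M)"
proof (rule finite_subset)
  show "river M \<subseteq> {-M..M} \<times> {0..M} \<times> {0..M}"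
  proof
    fix x assume "x \<in> river M"
    then obtain a d e where x: "x = (a, d, e)" and "(a, d, e) \<in> river M" by (cases x) auto
    then have "a\<^sup>2 + 2 * d * e = M" "0 < d" "0 < e" by (auto simp: river_def)
    with river_bounds[OF this] show "x \<in> {-M..M} \<times> {0..M} \<times> {0..M}" by (auto simp: x)
  qed
qed auto

lemma finite_odd_river: "finite (odd_river M)"
proof (rule finite_subset)
  show "odd_river M \<subseteq> {-M..M} \<times> {0..M} \<times> {0..M}"
  proof
    fix x assume "x \<in> odd_river M"
    then obtain a d e where x: "x = (a, d, e)" and "(a, d, e) \<in> odd_river M" by (cases x) auto
    then have "a\<^sup>2 + 1 * d * e = M" "0 < d" "0 < e" by (auto simp: odd_river_def)
    with river_bounds[OF this] show "x \<in> {-M..M} \<times> {0..M} \<times> {0..M}" by (auto simp: x)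
  qed
qed auto

text \<open>\<open>M\<close> is odd, so \<open>a\<close> is odd and \<open>a^2\<close> is 1 modulo
  8, which leaves 2 modulo 8 for \<open>2 * d * e\<close>.\<close>

lemma river_mod4:
  fixes M a d e :: int
  assumes "M mod 8 = 3" "a\<^sup>2 + 2 * d * e = M"
  shows "odd a" "d * e mod 4 = 1"
proof -
  have "M = a\<^sup>2 + 2 * (d * e)" using assms by simp
  moreover have "odd M" using assms(1) by presburger
  ultimately have "odd (a\<^sup>2)" by simp
  then show "odd a" by simp
  from odd_square_mod8[OF this] show "d * e mod 4 = 1" using assms
    by (simp add: mult.assoc) presburger
qed

lemma prod_mod4:
  fixes d e :: int
  assumes "d * e mod 4 = 1"
  shows "odd d" "odd e" "(d - e) mod 4 = 0"
proof -
  have *: "d * e mod 4 = (d mod 4) * (e mod 4) mod 4" by (simp add: mod_mult_eq)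
  have "d mod 4 = 1 \<and> e mod 4 = 1 \<or> d mod 4 = 3 \<and> e mod 4 = 3"
    using assms unfolding * by (cases d rule: mod4_cases; cases e rule: mod4_cases) simp_all
  then show "odd d" "odd e" "(d - e) mod 4 = 0" by presburger+
qed

lemma prod_mod4_3:
  fixes d e :: int
  assumes "d * e mod 4 = 3"
  shows "odd d" "odd e" "(d + e) mod 4 = 0"
proof -
  have *: "d * e mod 4 = (d mod 4) * (e mod 4) mod 4" by (simp add: mod_mult_eq)
  have "d mod 4 = 1 \<and> e mod 4 = 3 \<or> d mod 4 = 3 \<and> e mod 4 = 1"
    using assms unfolding * by (cases d rule: mod4_cases; cases e rule: mod4_cases) simp_all
  then show "odd d" "odd e" "(d + e) mod 4 = 0" by presburger+
qed

text \<open>Two symmetries meet. Sending \<open>(b, y, w)\<close> to \<open>(-b, w, y)\<close>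
  preserves the summand, because 4 divides \<open>y + w\<close> and so
  \<open>chi w = - chi y\<close>, and it reverses the sign of \<open>y - w + 2 * b\<close>. Sending
  \<open>b\<close> to \<open>-b\<close> negates the summand. Hence the full sum is zero, and it is
  twice the half in question.\<close>

lemma odd_river_sum:
  assumes M: "M mod 8 = 3"
  shows "(\<Sum>(b, y, w)\<in>{(b, y, w)\<in>odd_river M. y - w + 2 * b < 0}. chi y * (w + y) * b) = 0"
proof -
  define F where "F = (\<lambda>(b::int, y::int, w::int). chi y * (w + y) * b)"
  let ?N = "{(b, y, w)\<in>odd_river M. y - w + 2 * b < 0}"
  let ?P = "{(b, y, w)\<in>odd_river M. y - w + 2 * b > 0}"
  have mod4: "(y + w) mod 4 = 0" "odd y" if "(b, y, w) \<in> odd_river M" for b y w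
  proof -
    from that obtain c where c: "b = 2 * c" "b\<^sup>2 + y * w = M" unfolding odd_river_def by auto
    have "y * w = M - 4 * c\<^sup>2" using c by (simp add: power2_eq_square)
    then have "y * w mod 4 = 3" using M by presburger
    from prod_mod4_3[OF this] show "(y + w) mod 4 = 0" "odd y" by auto
  qed
  have "odd_river M = ?N \<union> ?P"
  proof -
    \<comment> \<open>\<open>y + w\<close> and \<open>2 * b\<close> are multiples of 4 and
      \<open>w\<close> is odd, so this number is 2 modulo 4.\<close>
    have "y - w + 2 * b \<noteq> 0" if "(b, y, w) \<in> odd_river M" for b y w
    proof -
      from that obtain c where c: "b = 2 * c" unfolding odd_river_def by auto
      show ?thesis using mod4[OF that] unfolding c by presburger
    qed
    then show ?thesis by fastforce
  qed
  moreover have "?N \<inter> ?P = {}" by auto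
  moreover have "finite ?N" "finite ?P"
    by (auto intro: finite_subset[OF _ finite_odd_river[of M]])
  ultimately have sp: "sum F (odd_river M) = sum F ?N + sum F ?P"
    by (metis (no_types, lifting) sum.union_disjoint)
  have np: "sum F ?N = sum F ?P"
    by (rule sum.reindex_bij_witness[where i="\<lambda>(b, y, w). (-b, w, y)" and j="\<lambda>(b, y, w). (-b, w, y)"])
      (auto simp: odd_river_def F_def algebra_simps chi_minus_eq[OF mod4(1)] )
  have "sum F (odd_river M) = (\<Sum>x\<in>odd_river M. - F x)"
    by (rule sum.reindex_bij_witness[where i="\<lambda>(b, y, w). (-b, y, w)" and j="\<lambda>(b, y, w). (-b, y, w)"])
      (auto simp: odd_river_def F_def)
  then have "sum F (odd_river M) = 0" by (simp add: sum_negf)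
  with sp np have "sum F ?N = 0" by simp
  then show ?thesis unfolding F_def .
qed

text \<open>
  The weight \<open>(e - a) * (a + d)\<close> is the share of the edge at one of its two end vertices. The third
  value at that vertex is \<open>2 * a - 2 * e + d\<close>, and its sign decides where the river goes on.
\<close>

lemma river_sum:
  assumes M: "M mod 8 = 3"
  shows "(\<Sum>(a, d, e)\<in>river M. chi d * (d * e - a\<^sup>2)) = 0"
proof -
  define G where "G = (\<lambda>(a::int, d::int, e::int). chi d * ((e - a) * (a + d)))"
  let ?N = "{(a, d, e)\<in>river M. 2 * a - 2 * e + d < 0}"
  let ?P = "{(a, d, e)\<in>river M. 2 * a - 2 * e + d > 0}"
  have odds: "odd a" "odd d" "odd e" "d * e mod 4 = 1" "2 * a - 2 * e + d \<noteq> 0" "chi (2 * a - 2 * e + d) = chi d"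
    if "(a, d, e) \<in> river M" for a d e
  proof -
    have *: "a\<^sup>2 + 2 * d * e = M" using that by (simp add: river_def)
    show o: "odd a" "d * e mod 4 = 1" using river_mod4[OF M *] by auto
    show o': "odd d" "odd e" using prod_mod4[OF o(2)] by auto
    show "2 * a - 2 * e + d \<noteq> 0" using o o' by presburger
    show "chi (2 * a - 2 * e + d) = chi d" by (rule chi_cong) (use o o' in presburger)
  qed
  have "river M = ?N \<union> ?P" using odds(5) by fastforce
  moreover have "?N \<inter> ?P = {}" by auto
  moreover have "finite ?N" "finite ?P"
    by (auto intro: finite_subset[OF _ finite_river[of M]])
  ultimately have sp: "sum G (river M) = sum G ?N + sum G ?P"
    by (metis (no_types, lifting) sum.union_disjoint)
  \<comment> \<open>A positive third value \<open>d + 2 * a - 2 * e\<close> replaces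
    \<open>d\<close> while \<open>e\<close> stays. This involution fixes \<open>a + d\<close> and
    \<open>chi d\<close> and negates \<open>e - a\<close>, so it negates \<open>G\<close>.\<close>
  have "sum G ?P = (\<Sum>x\<in>?P. - G x)"
  proof (rule sum.reindex_bij_witness[where i="\<lambda>(a, d, e). (2 * e - a, d + 2 * a - 2 * e, e)" and j="\<lambda>(a, d, e). (2 * e - a, d + 2 * a - 2 * e, e)"]; clarify)
    fix a d e assume h: "(a, d, e) \<in> river M" "2 * a - 2 * e + d > 0"
    show "- G (2 * e - a, d + 2 * a - 2 * e, e) = G (a, d, e)"
      using odds(6)[OF h(1)] unfolding G_def by (simp add: algebra_simps)
  qed (auto simp: river_def power2_eq_square algebra_simps)
  then have P: "sum G ?P = 0" by (simp add: sum_negf)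
  \<comment> \<open>If the third value is negative, then it and \<open>d\<close> bound an edge of
    the odd river, with \<open>b = - a - d\<close>. For this edge \<open>y - w + 2 * b\<close>
    equals \<open>- 2 * e\<close>.\<close>
  let ?B = "{(b, y, w)\<in>odd_river M. y - w + 2 * b < 0}"
  have AB: "(- a - d, d, 2 * e - 2 * a - d) \<in> ?B"
    if h: "(a, d, e) \<in> river M" "2 * a - 2 * e + d < 0" for a d e
    using h odds[OF h(1)] by (simp add: river_def odd_river_def power2_eq_square algebra_simps)
  \<comment> \<open>The inverse recovers \<open>e = k - b\<close>, which is positive by the
    inequality defining \<open>?B\<close>.\<close>
  have BA: "\<exists>k. w = y + 2 * k \<and> (- b - y, y, k - b) \<in> ?N"
    if h: "(b, y, w) \<in> odd_river M" "y - w + 2 * b < 0" for b y w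
  proof -
    from h(1) obtain c where c: "b = 2 * c" "b\<^sup>2 + y * w = M" unfolding odd_river_def by auto
    have "y * w = M - 4 * c\<^sup>2" using c by (simp add: power2_eq_square)
    then have "y * w mod 4 = 3" using M by presburger
    then have "(y + w) mod 4 = 0" "odd y" "odd w" using prod_mod4_3 by auto
    then have "even (w - y)" by simp
    then obtain k where "w - y = 2 * k" by (elim evenE)
    then have k: "w = y + 2 * k" by simp
    have "(- b - y, y, k - b) \<in> ?N"
      using h unfolding k by (simp add: river_def odd_river_def power2_eq_square algebra_simps)
    with k show ?thesis by blast
  qed
  have "2 * sum G ?N = - (\<Sum>(b, y, w)\<in>?B. chi y * (w + y) * b)"
    unfolding sum_distrib_left sum_negf[symmetric]
  proof (rule sum.reindex_bij_witness[where i="\<lambda>(b, y, w). (-b-y, y, (w - y) div 2 - b)" and j="\<lambda>(a, d, e). (-a-d, d, 2*e-2*a-d)"], goal_cases)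
    case (1 x) then show ?case by (auto simp: algebra_simps)
  next
    case (2 x) then show ?case using AB by auto
  next
    case (3 x) then show ?case using BA by fastforce
  next
    case (4 x) then show ?case using BA by fastforce
  next
    case (5 x) then show ?case by (auto simp: G_def algebra_simps)
  qed
  then have N: "sum G ?N = 0" using odd_river_sum[OF M] by simp
  \<comment> \<open>Averaging the weight over \<open>a\<close> and \<open>-a\<close>, a symmetry of
    \<open>river M\<close>, leaves \<open>d * e - a^2\<close>.\<close>
  have "(\<Sum>(a, d, e)\<in>river M. chi d * ((e - a) * (a + d))) = (\<Sum>(a, d, e)\<in>river M. chi d * ((e + a) * (d - a)))"
    by (rule sum.reindex_bij_witness[where i="\<lambda>(a, d, e). (-a, d, e)" and j="\<lambda>(a, d, e). (-a, d, e)"])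
      (auto simp: river_def)
  moreover have "(\<Sum>(a, d, e)\<in>river M. chi d * ((e - a) * (a + d))) + (\<Sum>(a, d, e)\<in>river M. chi d * ((e + a) * (d - a)))
      = 2 * (\<Sum>(a, d, e)\<in>river M. chi d * (d * e - a\<^sup>2))"
    unfolding sum.distrib[symmetric] sum_distrib_left
    by (rule sum.cong) (auto simp: algebra_simps power2_eq_square)
  moreover have "(\<Sum>(a, d, e)\<in>river M. chi d * ((e - a) * (a + d))) = 0"
    using sp P N unfolding G_def by simp
  ultimately show ?thesis by simp
qed

section \<open>Sums of two squares\<close>

definition two_squares :: "int \<Rightarrow> (int \<times> int) set" where
  "two_squares n = {(p, q). p\<^sup>2 + q\<^sup>2 = n}"

definition pos_divisors :: "int \<Rightarrow> int set" where
  "pos_divisors n = {d. 0 < d \<and> d dvd n}"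

definition chi_divisor_sum :: "int \<Rightarrow> int" where
  "chi_divisor_sum n = (\<Sum>d\<in>pos_divisors n. chi d)"

lemma finite_pos_divisors: "n \<noteq> 0 \<Longrightarrow> finite (pos_divisors n)"
  by (rule finite_subset[of _ "{0..\<bar>n\<bar>}"]) (auto simp: pos_divisors_def dest: dvd_imp_le_int)

lemma finite_two_squares: "finite (two_squares n)"
proof (rule finite_subset)
  show "two_squares n \<subseteq> {-n..n} \<times> {-n..n}"
  proof
    fix x assume "x \<in> two_squares n"
    then obtain p q where "x = (p, q)" "p\<^sup>2 + q\<^sup>2 = n" by (auto simp: two_squares_def)
    then show "x \<in> {-n..n} \<times> {-n..n}"
      using abs_le_square_int[of p] abs_le_square_int[of q] zero_le_power2[of p] zero_le_power2[of q] by auto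
  qed
qed simp

definition three_squares :: "int \<Rightarrow> (int \<times> int \<times> int) set" where
  "three_squares n = {(x, y, z). x\<^sup>2 + y\<^sup>2 + z\<^sup>2 = n}"

lemma finite_three_squares: "finite (three_squares n)"
proof (rule finite_subset)
  show "three_squares n \<subseteq> {-n..n} \<times> {-n..n} \<times> {-n..n}"
  proof
    fix x assume "x \<in> three_squares n"
    then obtain p q r where "x = (p, q, r)" "p\<^sup>2 + q\<^sup>2 + r\<^sup>2 = n" by (auto simp: three_squares_def)
    then show "x \<in> {-n..n} \<times> {-n..n} \<times> {-n..n}"
      using abs_le_square_int[of p] abs_le_square_int[of q]  abs_le_square_int[of r]
        zero_le_power2[of p] zero_le_power2[of q] zero_le_power2[of r] by auto
  qed
qed simp

section \<open>Three squares modulo 4, and two recurrences of the same shape\<close>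

lemma square_mod4: "(a::int)\<^sup>2 mod 4 = (if even a then 0 else 1)"
proof (cases "even a")
  case True
  then show ?thesis by (auto elim!: evenE simp: power2_eq_square)
next
  case False
  have "s mod 8 = 1 \<Longrightarrow> s mod 4 = 1" for s :: int by presburger
  from this[OF odd_square_mod8] False show ?thesis by simp
qed

lemma three_squares_mod4:
  "(x\<^sup>2 + y\<^sup>2 + z\<^sup>2) mod 4 = of_bool (odd x) + of_bool (odd y) + (of_bool (odd z) :: int)"
proof -
  have "(x\<^sup>2 + y\<^sup>2 + z\<^sup>2) mod 4 = ((x\<^sup>2 + y\<^sup>2) mod 4 + z\<^sup>2 mod 4) mod 4" by (rule mod_add_eq[symmetric])
  also have "(x\<^sup>2 + y\<^sup>2) mod 4 = (x\<^sup>2 mod 4 + y\<^sup>2 mod 4) mod 4" by (rule mod_add_eq[symmetric])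
  finally show ?thesis unfolding square_mod4 by (cases "even x"; cases "even y"; cases "even z") simp_all
qed

text \<open>The coordinates are interchangeable, so \<open>x^2\<close> is a third of
  \<open>n\<close> on average.\<close>

lemma three_squares_sum:
  "(\<Sum>(x, y, z)\<in>three_squares n. n - 3 * x\<^sup>2) = 0"
proof -
  have 1: "(\<Sum>(x, y, z)\<in>three_squares n. x\<^sup>2) = (\<Sum>(x, y, z)\<in>three_squares n. y\<^sup>2)"
    by (rule sum.reindex_bij_witness[where i="\<lambda>(x, y, z). (y, x, z)" and j="\<lambda>(x, y, z). (y, x, z)"])
      (auto simp: three_squares_def)
  have 2: "(\<Sum>(x, y, z)\<in>three_squares n. x\<^sup>2) = (\<Sum>(x, y, z)\<in>three_squares n. z\<^sup>2)"
    by (rule sum.reindex_bij_witness[where i="\<lambda>(x, y, z). (z, y, x)" and j="\<lambda>(x, y, z). (z, y, x)"])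
      (auto simp: three_squares_def)
  have "(\<Sum>(x, y, z)\<in>three_squares n. n - 3 * x\<^sup>2)
      = (\<Sum>(x, y, z)\<in>three_squares n. (y\<^sup>2 - x\<^sup>2) + (z\<^sup>2 - x\<^sup>2))"
    by (rule sum.cong) (auto simp: three_squares_def)
  also have "\<dots> = (\<Sum>(x, y, z)\<in>three_squares n. y\<^sup>2) - (\<Sum>(x, y, z)\<in>three_squares n. x\<^sup>2)
     + ((\<Sum>(x, y, z)\<in>three_squares n. z\<^sup>2) - (\<Sum>(x, y, z)\<in>three_squares n. x\<^sup>2))"
    by (simp add: sum.distrib sum_subtractf case_prod_unfold sum_distrib_left sum_negf)
  finally show ?thesis using 1 2 by simp
qed

lemma finite_odd_squares_below: "finite {a. odd a \<and> a\<^sup>2 < (M::int)}"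
proof (rule finite_subset)
  show "{a. odd a \<and> a\<^sup>2 < M} \<subseteq> {-M..M}"
  proof
    fix a assume "a \<in> {a. odd a \<and> a\<^sup>2 < M}"
    then show "a \<in> {-M..M}" using abs_le_square_int[of a] by auto
  qed
qed simp

text \<open>This is \<open>three_squares_sum\<close> grouped by the first coordinate. As
  \<open>M\<close> is 3 modulo 4, all coordinates are odd, so the first one is odd with square below
  \<open>M\<close>.\<close>

lemma two_squares_recurrence:
  assumes M: "M mod 8 = 3"
  shows "(\<Sum>a\<in>{a. odd a \<and> a\<^sup>2 < M}. (M - 3 * a\<^sup>2) * int (card (two_squares (M - a\<^sup>2)))) = 0"
proof -
  have odd: "odd x \<and> x\<^sup>2 < M" if h: "x\<^sup>2 + y\<^sup>2 + z\<^sup>2 = M" for x y z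
  proof -
    have "M mod 4 = 3" using M by presburger
    then have "odd x \<and> odd y" using three_squares_mod4[of x y z] h by (auto simp: of_bool_def split: if_splits)
    moreover have "0 < y\<^sup>2" "0 \<le> z\<^sup>2" using calculation by auto
    ultimately show ?thesis using h by linarith
  qed
  note fin = finite_odd_squares_below[of M]
  have "(\<Sum>a\<in>{a. odd a \<and> a\<^sup>2 < M}. (M - 3 * a\<^sup>2) * int (card (two_squares (M - a\<^sup>2))))
     = (\<Sum>a\<in>{a. odd a \<and> a\<^sup>2 < M}. \<Sum>u\<in>two_squares (M - a\<^sup>2). M - 3 * a\<^sup>2)"
    by (simp add: mult.commute)
  also have "\<dots> = (\<Sum>(a, u)\<in>Sigma {a. odd a \<and> a\<^sup>2 < M} (\<lambda>a. two_squares (M - a\<^sup>2)). M - 3 * a\<^sup>2)"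
    by (rule sum.Sigma) (auto simp: fin finite_two_squares)
  also have "Sigma {a. odd a \<and> a\<^sup>2 < M} (\<lambda>a. two_squares (M - a\<^sup>2)) = three_squares M"
    using odd by (auto simp: two_squares_def three_squares_def)
  finally show ?thesis using three_squares_sum[of M] by (simp add: case_prod_unfold)
qed

text \<open>Writing \<open>(M - a^2) div 2 = d * e\<close> turns the pairs of \<open>a\<close> and a
  divisor \<open>d\<close> into \<open>river M\<close>, and the weight \<open>M - 3 * a^2\<close>
  into \<open>2 * (d * e - a^2)\<close>, so that \<open>river_sum\<close> applies.\<close>

lemma chi_divisor_sum_recurrence:
  assumes M: "M mod 8 = 3"
  shows "(\<Sum>a\<in>{a. odd a \<and> a\<^sup>2 < M}. (M - 3 * a\<^sup>2) * chi_divisor_sum ((M - a\<^sup>2) div 2)) = 0"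
proof -
  note fin = finite_odd_squares_below[of M]
  have half: "M - a\<^sup>2 = 2 * ((M - a\<^sup>2) div 2)" if "odd a" for a
  proof -
    have "odd M" using M by presburger
    then have "even (M - a\<^sup>2)" using that by simp
    then show ?thesis by simp
  qed
  have "(\<Sum>a\<in>{a. odd a \<and> a\<^sup>2 < M}. (M - 3 * a\<^sup>2) * chi_divisor_sum ((M - a\<^sup>2) div 2))
     = (\<Sum>a\<in>{a. odd a \<and> a\<^sup>2 < M}. \<Sum>d\<in>pos_divisors ((M - a\<^sup>2) div 2). (M - 3 * a\<^sup>2) * chi d)"
    by (simp add: chi_divisor_sum_def sum_distrib_left)
  also have "\<dots> = (\<Sum>(a, d)\<in>Sigma {a. odd a \<and> a\<^sup>2 < M} (\<lambda>a. pos_divisors ((M - a\<^sup>2) div 2)). (M - 3 * a\<^sup>2) * chi d)"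
  proof (rule sum.Sigma)
    show "\<forall>a\<in>{a. odd a \<and> a\<^sup>2 < M}. finite (pos_divisors ((M - a\<^sup>2) div 2))"
    proof
      fix a assume a: "a \<in> {a. odd a \<and> a\<^sup>2 < M}"
      show "finite (pos_divisors ((M - a\<^sup>2) div 2))"
        by (rule finite_pos_divisors) (use a half[of a] in auto)
    qed
  qed (rule fin)
  also have "\<dots> = (\<Sum>(a, d, e)\<in>river M. 2 * (chi d * (d * e - a\<^sup>2)))"
  proof (rule sum.reindex_bij_witness[where i="\<lambda>(a, d, e). (a, d)" and j="\<lambda>(a, d). (a, d, (M - a\<^sup>2) div 2 div d)"], goal_cases)
    case (1 x) then show ?case by auto
  next
    case (2 x)
    then obtain a d where x: "x = (a, d)" "odd a" "a\<^sup>2 < M" "0 < d" "d dvd (M - a\<^sup>2) div 2"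
      by (auto simp: pos_divisors_def)
    then obtain k where k: "(M - a\<^sup>2) div 2 = d * k" by auto
    have "0 < d * k" using x half[of a] k by linarith
    then have "0 < k" using x by (simp add: zero_less_mult_iff)
    then show ?case using k x half[of a] by (auto simp: river_def)
  next
    case (3 x)
    then show ?case by (auto simp: river_def)
  next
    case (4 x)
    then obtain a d e where x: "x = (a, d, e)" "0 < d" "0 < e" "a\<^sup>2 + 2 * d * e = M" by (auto simp: river_def)
    have o: "odd a" using river_mod4[OF M x(4)] by simp
    have h: "(M - a\<^sup>2) div 2 = d * e" "M - a\<^sup>2 = 2 * (d * e)" using x by auto
    have "0 < d * e" using x by simp
    then have "a\<^sup>2 < M" using h by linarith
    then show ?case using o x h by (auto simp: pos_divisors_def)
  next
    case (5 x)
    then obtain a d where x: "x = (a, d)" "odd a" "a\<^sup>2 < M" "0 < d" "d dvd (M - a\<^sup>2) div 2"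
      by (auto simp: pos_divisors_def)
    then obtain k where k: "(M - a\<^sup>2) div 2 = d * k" by auto
    have "M - a\<^sup>2 = 2 * (d * k)" using half[OF x(2)] k by simp
    then have "M - 3 * a\<^sup>2 = 2 * (d * k - a\<^sup>2)" by simp
    then show ?case using k x by simp
  qed
  also have "\<dots> = 2 * (\<Sum>(a, d, e)\<in>river M. chi d * (d * e - a\<^sup>2))"
    by (simp add: sum_distrib_left case_prod_unfold)
  finally show ?thesis using river_sum[OF M] by simp
qed

section \<open>Solving the recurrence by induction\<close>

lemma chi_divisor_sum_1: "chi_divisor_sum 1 = 1"
proof -
  have "pos_divisors 1 = {1}" by (auto simp: pos_divisors_def)
  then show ?thesis by (simp add: chi_divisor_sum_def)
qed

lemma card_two_squares_2: "card (two_squares 2) = 4"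
proof -
  have "two_squares 2 = {(1, 1), (1, -1), (-1, 1), (-1, -1)}" (is "_ = ?R")
  proof
    show "two_squares 2 \<subseteq> ?R"
    proof
      fix x assume "x \<in> two_squares 2"
      then obtain p q where x: "x = (p, q)" "p\<^sup>2 + q\<^sup>2 = 2" by (auto simp: two_squares_def)
      have "p\<^sup>2 \<le> 2" "q\<^sup>2 \<le> 2" using x(2) zero_le_power2[of p] zero_le_power2[of q] by linarith+
      then have "\<bar>p\<bar> \<le> 2" "\<bar>q\<bar> \<le> 2" using abs_le_square_int[of p] abs_le_square_int[of q] by linarith+
      then have "p \<in> {-2, -1, 0, 1, 2}" "q \<in> {-2, -1, 0, 1, 2}" by auto
      then show "x \<in> ?R" using x by auto
    qed
  qed (auto simp: two_squares_def)
  then show ?thesis by simp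
qed

text \<open>In the two recurrences for \<open>M = 2 * n + 1\<close>, the terms \<open>a = 1\<close>
  and \<open>a = -1\<close> involve \<open>n\<close> itself, and all others involve smaller numbers
  that are again 1 modulo 4. The coefficient \<open>M - 3\<close> of the leading terms is nonzero
  except for \<open>n = 1\<close>, the base case.\<close>

theorem card_two_squares:
  fixes n :: int
  assumes "0 < n" "n mod 4 = 1"
  shows "int (card (two_squares (2 * n))) = 4 * chi_divisor_sum n"
  using assms
proof (induction "nat n" arbitrary: n rule: less_induct)
  case less
  show ?case
  proof (cases "n = 1")
    case True
    then show ?thesis by (simp add: chi_divisor_sum_1 card_two_squares_2)
  next
    case False
    define M where "M = 2 * n + 1"
    have M: "M mod 8 = 3" using less.prems unfolding M_def by presburger
    let ?A = "{a. odd a \<and> a\<^sup>2 < M}"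
    \<comment> \<open>The summand of the difference of the two recurrences: it contains the error of
      the claim at \<open>(M - a^2) div 2\<close>.\<close>
    define h where "h = (\<lambda>a. (M - 3 * a\<^sup>2) * (int (card (two_squares (M - a\<^sup>2))) - 4 * chi_divisor_sum ((M - a\<^sup>2) div 2)))"
    have "sum h ?A = 0"
    proof -
      have "sum h ?A = (\<Sum>a\<in>?A. (M - 3 * a\<^sup>2) * int (card (two_squares (M - a\<^sup>2))))
          - 4 * (\<Sum>a\<in>?A. (M - 3 * a\<^sup>2) * chi_divisor_sum ((M - a\<^sup>2) div 2))"
        unfolding h_def sum_distrib_left sum_subtractf[symmetric] by (rule sum.cong) (auto simp: algebra_simps)
      then show ?thesis using two_squares_recurrence[OF M] chi_divisor_sum_recurrence[OF M] by simp
    qed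
    moreover have "sum h ?A = sum h {1, -1}"
    proof (rule sum.mono_neutral_right)
      show "finite ?A" by (rule finite_odd_squares_below)
      show "{1, -1} \<subseteq> ?A" using less.prems unfolding M_def by auto
      show "\<forall>a\<in>?A - {1, -1}. h a = 0"
      proof
        fix a assume a: "a \<in> ?A - {1, -1}"
        then have a': "odd a" "a\<^sup>2 < M" "a\<^sup>2 \<noteq> 1" by (auto simp: power2_eq_1_iff)
        have "a\<^sup>2 mod 8 = 1" using odd_square_mod8[OF a'(1)] .
        then have "(M - a\<^sup>2) mod 8 = 2" using mod_diff_eq[of M 8 "a\<^sup>2"] M by simp
        moreover have "s mod 8 = 2 \<Longrightarrow> s = 2 * (s div 2) \<and> s div 2 mod 4 = 1" for s :: int by presburger
        ultimately have k: "M - a\<^sup>2 = 2 * ((M - a\<^sup>2) div 2)" "(M - a\<^sup>2) div 2 mod 4 = 1" by blast+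
        have "a\<^sup>2 > 0" using a'(1) by auto
        with a'(3) have "a\<^sup>2 > 1" using a' by linarith
        then have "(M - a\<^sup>2) div 2 < n" "0 < (M - a\<^sup>2) div 2" using a' k unfolding M_def by linarith+
        then have "int (card (two_squares (2 * ((M - a\<^sup>2) div 2)))) = 4 * chi_divisor_sum ((M - a\<^sup>2) div 2)"
          using less.prems k(2) by (intro less.hyps) auto
        then show "h a = 0" using k(1) by (simp add: h_def)
      qed
    qed
    moreover have "sum h {1, -1} = 2 * (M - 3) * (int (card (two_squares (2 * n))) - 4 * chi_divisor_sum n)"
      by (simp add: h_def M_def)
    moreover have "M - 3 \<noteq> 0" using False unfolding M_def by auto
    ultimately show ?thesis by simp
  qed
qed

text \<open>The substitution \<open>(x + y, x - y)\<close> doubles the sum of squares. It is onto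
  because \<open>p\<close> and \<open>q\<close> have equal parity when \<open>p^2 + q^2\<close> is
  even.\<close>

lemma card_two_squares_odd:
  fixes n :: int
  assumes "0 < n" "n mod 4 = 1"
  shows "int (card (two_squares n)) = 4 * chi_divisor_sum n"
proof -
  have "bij_betw (\<lambda>(x, y). (x + y, x - y)) (two_squares n) (two_squares (2 * n))"
  proof (rule bij_betw_byWitness[where f'="\<lambda>(p, q). ((p + q) div 2, (p - q) div 2)"])
    show "\<forall>a'\<in>two_squares (2 * n). (\<lambda>(x, y). (x + y, x - y)) ((\<lambda>(p, q). ((p + q) div 2, (p - q) div 2)) a') = a'"
     and "(\<lambda>(p, q). ((p + q) div 2, (p - q) div 2)) ` two_squares (2 * n) \<subseteq> two_squares n"
    proof -
      have "\<exists>x y. p = x + y \<and> q = x - y \<and> x\<^sup>2 + y\<^sup>2 = n" if h: "p\<^sup>2 + q\<^sup>2 = 2 * n" for p q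
      proof -
        have "even (p\<^sup>2 + q\<^sup>2)" using h by simp
        then have "even (p + q)" by simp
        then obtain x where x: "p + q = 2 * x" by (elim evenE)
        then have q: "q = 2 * x - p" by simp
        have "p = x + (p - x)" "q = x - (p - x)" using q by auto
        moreover have "x\<^sup>2 + (p - x)\<^sup>2 = n" using h unfolding q by (simp add: power2_eq_square algebra_simps)
        ultimately show ?thesis by blast
      qed
      note * = this
      show "\<forall>a'\<in>two_squares (2 * n). (\<lambda>(x, y). (x + y, x - y)) ((\<lambda>(p, q). ((p + q) div 2, (p - q) div 2)) a') = a'"
       and "(\<lambda>(p, q). ((p + q) div 2, (p - q) div 2)) ` two_squares (2 * n) \<subseteq> two_squares n"
        by (auto simp: two_squares_def dest!: *)
    qed
  qed (auto simp: two_squares_def power2_eq_square algebra_simps)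
  then have "card (two_squares n) = card (two_squares (2 * n))" by (rule bij_betw_same_card)
  then show ?thesis using card_two_squares[OF assms] by simp
qed

section \<open>Dirichlet's sum of character products\<close>

definition odd_products :: "int \<Rightarrow> (int \<times> int \<times> int \<times> int) set" where
  "odd_products n = {(a, a', b, b'). odd a \<and> odd a' \<and> odd b \<and> odd b' \<and>
     0 < a \<and> 0 < a' \<and> 0 < b \<and> 0 < b' \<and> a * a' + b * b' = n}"

lemma finite_odd_products: "finite (odd_products n)"
proof (rule finite_subset)
  show "odd_products n \<subseteq> {0..n} \<times> {0..n} \<times> {0..n} \<times> {0..n}"
  proof
    fix x assume "x \<in> odd_products n"
    then obtain a a' b b' where x: "x = (a, a', b, b')" "0 < a" "0 < a'" "0 < b" "0 < b'" "a * a' + b * b' = n"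
      by (auto simp: odd_products_def)
    have "0 < a * a'" "0 < b * b'" using x by auto
    with pos_mult_ge[OF x(2,3)] pos_mult_ge[OF x(4,5)] x(6)
    have "a \<le> n" "a' \<le> n" "b \<le> n" "b' \<le> n" by linarith+
    with x show "x \<in> {0..n} \<times> {0..n} \<times> {0..n} \<times> {0..n}" by auto
  qed
qed simp

text \<open>
  Dirichlet's involution on the products with \<open>b < a\<close>. It acts by the symmetric matrix
  \<open>((n + 2, n + 1), (n + 1, n))\<close> of determinant \<open>-1\<close> on \<open>(a', b')\<close>, and by its inverse on \<open>(a, b)\<close>;
  \<open>n\<close> is chosen such that the images stay positive.
\<close>

definition dirichlet_swap :: "int \<times> int \<times> int \<times> int \<Rightarrow> int \<times> int \<times> int \<times> int" where
  "dirichlet_swap = (\<lambda>(a, a', b, b').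
     let n = b div (a - b); r = b mod (a - b); s = a' + b'
     in (a' + n * s + s, r, a' + n * s, a - b - r))"

lemma dirichlet_swap:
  assumes m: "odd m" and h: "(a, a', b, b') \<in> odd_products (2 * m)" "b < a"
    and x: "(c, c', d, d') = dirichlet_swap (a, a', b, b')"
  shows "(c, c', d, d') \<in> odd_products (2 * m)" "d < c"
    "dirichlet_swap (c, c', d, d') = (a, a', b, b')" "chi c * chi d = - (chi a * chi b)"
proof -
  define D where "D = a - b"
  define n where "n = b div D"
  define r where "r = b mod D"
  have o: "odd a" "odd a'" "odd b" "odd b'" "0 < a" "0 < a'" "0 < b" "0 < b'" "a * a' + b * b' = 2 * m"
    using h by (auto simp: odd_products_def)
  have D: "even D" "0 < D" "a = b + D" using o h unfolding D_def by auto
  have b: "b = n * D + r" unfolding n_def r_def by simp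
  \<comment> \<open>\<open>b\<close> is odd and \<open>D\<close> is even, so \<open>r\<close> is
    odd. Hence \<open>r\<close> and \<open>D - r\<close>, the new \<open>c'\<close> and
    \<open>d'\<close>, are odd and positive.\<close>
  have "odd (n * D + r)" using o(3) unfolding b[symmetric] .
  then have "odd r" using D(1) by simp
  moreover have "0 \<le> r" "r < D" using D(2) by (simp_all add: r_def)
  ultimately have r: "0 \<le> r" "r < D" "odd r" by auto
  then have r0: "0 < r" by (cases "r = 0") auto
  have n0: "0 \<le> n" using o D by (simp add: n_def pos_imp_zdiv_nonneg_iff)
  have cd: "c = a' + n * (a' + b') + (a' + b')" "c' = r" "d = a' + n * (a' + b')" "d' = D - r"
    using x by (simp_all add: dirichlet_swap_def Let_def D_def n_def r_def)
  have e: "c * c' + d * d' = 2 * m"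
    unfolding cd o(9)[symmetric] D(3) unfolding b by (simp add: algebra_simps)
  have d0: "0 < d" unfolding cd using o n0 by (intro add_pos_nonneg) auto
  have c0: "0 < c" unfolding cd(1) using d0 o unfolding cd by simp
  show "(c, c', d, d') \<in> odd_products (2 * m)"
    unfolding odd_products_def using e d0 c0 r r0 D o by (auto simp: cd)
  show "d < c" using o by (simp add: cd)
  \<comment> \<open>Division of \<open>d\<close> by \<open>c - d\<close> gives the same quotient
    \<open>n\<close> and the remainder \<open>a'\<close>, so a second application undoes the
    first.\<close>
  have "c - d = a' + b'" by (simp add: cd)
  moreover have "d div (a' + b') = n" "d mod (a' + b') = a'" unfolding cd using o by auto
  ultimately show "dirichlet_swap (c, c', d, d') = (a, a', b, b')"
    unfolding dirichlet_swap_def Let_def using b D by (simp add: cd algebra_simps)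
  \<comment> \<open>Put \<open>a - b = 2 * u\<close> and \<open>c - d = a' + b' = 2 * v\<close>. For
    odd arguments the product of characters is 1 or -1 according to whether 4 divides the
    difference, that is, to the parity of \<open>u\<close> and of \<open>v\<close>. These parities
    differ, because \<open>m = b * v + u * a'\<close> is odd; this is where the oddness of
    \<open>m\<close> enters.\<close>
  show "chi c * chi d = - (chi a * chi b)"
  proof -
    from D(1) obtain u where u: "D = 2 * u" by (elim evenE)
    have "even (a' + b')" using o by simp
    then obtain v where v: "a' + b' = 2 * v" by (elim evenE)
    have "2 * m = b * (a' + b') + 2 * (u * a')"
      unfolding o(9)[symmetric] D(3) u by (simp add: algebra_simps)
    then have "2 * m = 2 * (b * v + u * a')" unfolding v by simp
    then have "m = b * v + u * a'" by (metis mult_cancel_left zero_neq_numeral)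
    then have "odd (b * v + u * a')" using m by simp
    then have uv: "odd (u + v)" using o by auto
    have 1: "chi a * chi b = (if even u then 1 else -1)"
    proof (cases "even u")
      case True
      then have "chi a = chi b" using D(3) u True by (intro chi_cong) presburger
      then show ?thesis using True chi_odd_square[OF o(3)] by simp
    next
      case False
      then have "chi a = - chi b" using D(3) u o(3) False by (intro chi_minus_eq) presburger
      then show ?thesis using False chi_odd_square[OF o(3)] by simp
    qed
    have dodd: "odd d" unfolding cd v using o by simp
    have cv: "c = d + 2 * v" using cd v by simp
    have 2: "chi c * chi d = (if even v then 1 else -1)"
    proof (cases "even v")
      case True
      then have "chi c = chi d" using cv True by (intro chi_cong) presburger
      then show ?thesis using True chi_odd_square[OF dodd] by simp
    next
      case False
      then have "chi c = - chi d" using cv dodd False by (intro chi_minus_eq) presburger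
      then show ?thesis using False chi_odd_square[OF dodd] by simp
    qed
    show ?thesis unfolding 1 2 using uv by auto
  qed
qed

text \<open>The involution reverses the sign of each summand, so the sum equals its
  negative.\<close>

lemma sum_off_diagonal:
  assumes "odd m"
  shows "(\<Sum>(a, a', b, b')\<in>{(a, a', b, b')\<in>odd_products (2 * m). b < a}. chi a * chi b) = 0" (is "?S = 0")
proof -
  let ?A = "{(a, a', b, b')\<in>odd_products (2 * m). b < a}"
  have *: "dirichlet_swap x \<in> ?A \<and> dirichlet_swap (dirichlet_swap x) = x \<and>
     (case dirichlet_swap x of (a, a', b, b') \<Rightarrow> chi a * chi b) = - (case x of (a, a', b, b') \<Rightarrow> chi a * chi b)"
    if "x \<in> ?A" for x
  proof -
    obtain a a' b b' where x: "x = (a, a', b, b')" by (cases x)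
    obtain c c' d d' where y: "dirichlet_swap x = (c, c', d, d')" by (cases "dirichlet_swap x")
    show ?thesis using dirichlet_swap[OF assms, of a a' b b' c c' d d'] that y unfolding x by simp
  qed
  have "?S = (\<Sum>x\<in>?A. - (case x of (a, a', b, b') \<Rightarrow> chi a * chi b))"
  proof (rule sum.reindex_bij_witness[where i=dirichlet_swap and j=dirichlet_swap], goal_cases)
    case (5 x)
    from *[OF this] show ?case by linarith
  next
    case (1 x) from *[OF this] show ?case by (elim conjE)
  next
    case (2 x) from *[OF this] show ?case by (elim conjE)
  next
    case (3 x) from *[OF this] show ?case by (elim conjE)
  next
    case (4 x) from *[OF this] show ?case by (elim conjE)
  qed
  then show ?thesis by (simp add: sum_negf)
qed

text \<open>Here the characters cancel and \<open>a * (a' + b') = 2 * m\<close>. For each divisor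
  \<open>d = (a' + b') div 2\<close> of \<open>m\<close> there are \<open>d\<close> choices of the
  odd number \<open>a' = 2 * k + 1\<close> below \<open>2 * d\<close>.\<close>

lemma sum_diagonal:
  assumes "odd m" "0 < m"
  shows "(\<Sum>(a, a', b, b')\<in>{(a, a', b, b')\<in>odd_products (2 * m). a = b}. chi a * chi b) = (\<Sum>d\<in>pos_divisors m. d)"
proof -
  have "(\<Sum>(a, a', b, b')\<in>{(a, a', b, b')\<in>odd_products (2 * m). a = b}. chi a * chi b)
      = (\<Sum>(d, k)\<in>Sigma (pos_divisors m) (\<lambda>d. {0..<d}). 1)"
  proof (rule sum.reindex_bij_witness[where j="\<lambda>(a, a', b, b'). ((a' + b') div 2, a' div 2)" and
     i = "\<lambda>(d, k). (m div d, 2 * k + 1, m div d, 2 * (d - k) - 1)"], goal_cases)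
    case (3 x)
    then obtain d k where x: "x = (d, k)" "0 < d" "d dvd m" "0 \<le> k" "k < d" by (auto simp: pos_divisors_def)
    then show ?case by simp
  next
    case (4 x)
    then obtain d k where x: "x = (d, k)" "0 < d" "d dvd m" "0 \<le> k" "k < d" by (auto simp: pos_divisors_def)
    then obtain e where e: "m = d * e" by auto
    then have "0 < e" "odd e" using x assms by (auto simp: zero_less_mult_iff)
    then show ?case using x e by (auto simp: odd_products_def algebra_simps)
  next
    case (5 x)
    then show ?case by (auto simp: odd_products_def chi_odd_square)
  next
    case (1 x)
    then obtain a a' b' where x: "x = (a, a', a, b')" "odd a" "odd a'" "odd b'" "0 < a" "0 < a'" "0 < b'" "a * a' + a * b' = 2 * m"
      by (auto simp: odd_products_def)
    then obtain i j where ij: "a' = 2 * i + 1" "b' = 2 * j + 1" by (auto elim!: oddE)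
    then have "m = a * (i + j + 1)" "i + j + 1 > 0" using x by (auto simp: algebra_simps)
    then have "m div (i + j + 1) = a" by (metis less_irrefl nonzero_mult_div_cancel_right)
    moreover have "(a' + b') div 2 = i + j + 1" using ij by simp
    ultimately have "m div ((a' + b') div 2) = a" by (simp only:)
    then have "m div ((a' + b') div 2) = a \<and> 2 * (a' div 2) + 1 = a' \<and> 2 * ((a' + b') div 2 - a' div 2) - 1 = b'"
      using ij by simp
    then show ?case unfolding x by simp
  next
    case (2 x)
    then obtain a a' b' where x: "x = (a, a', a, b')" "odd a" "odd a'" "odd b'" "0 < a" "0 < a'" "0 < b'" "a * a' + a * b' = 2 * m"
      by (auto simp: odd_products_def)
    then obtain i j where ij: "a' = 2 * i + 1" "b' = 2 * j + 1" by (auto elim!: oddE)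
    then have "m = a * (i + j + 1)" "i + j + 1 > 0" using x by (auto simp: algebra_simps)
    then have "i + j + 1 dvd m" by simp
    moreover have "(a' + b') div 2 = i + j + 1" using ij by simp
    ultimately have "(a' + b') div 2 dvd m" by (simp only:)
    moreover have "0 < (a' + b') div 2" "a' div 2 < (a' + b') div 2" "0 \<le> a' div 2"
      using ij x(6,7) by auto
    ultimately show ?case unfolding x by (simp add: pos_divisors_def)
  qed
  also have "\<dots> = (\<Sum>d\<in>pos_divisors m. \<Sum>k\<in>{0..<d}. 1)"
    by (rule sum.Sigma[symmetric]) (use assms in \<open>auto simp: finite_pos_divisors\<close>)
  also have "\<dots> = (\<Sum>d\<in>pos_divisors m. d)"
    by (rule sum.cong) (auto simp: pos_divisors_def)
  finally show ?thesis .
qed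

text \<open>Exchanging the two products matches the part \<open>a < b\<close> with the vanishing
  part \<open>b < a\<close>, so only the diagonal contributes.\<close>

theorem sum_odd_products:
  assumes "odd m" "0 < m"
  shows "(\<Sum>(a, a', b, b')\<in>odd_products (2 * m). chi a * chi b) = (\<Sum>d\<in>pos_divisors m. d)"
proof -
  let ?F = "\<lambda>(a::int, a'::int, b::int, b'::int). chi a * chi b"
  let ?L = "{(a, a', b, b')\<in>odd_products (2 * m). a < b}"
  let ?E = "{(a, a', b, b')\<in>odd_products (2 * m). a = b}"
  let ?G = "{(a, a', b, b')\<in>odd_products (2 * m). b < a}"
  have fin: "finite ?L" "finite ?E" "finite ?G"
    by (auto intro: finite_subset[OF _ finite_odd_products[of "2 * m"]])
  have "odd_products (2 * m) = (?L \<union> ?E) \<union> ?G" by fastforce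
  then have "sum ?F (odd_products (2 * m)) = sum ?F ((?L \<union> ?E) \<union> ?G)" by simp
  also have "\<dots> = sum ?F (?L \<union> ?E) + sum ?F ?G" by (rule sum.union_disjoint) (use fin in auto)
  also have "sum ?F (?L \<union> ?E) = sum ?F ?L + sum ?F ?E" by (rule sum.union_disjoint) (use fin in auto)
  also have "sum ?F ?L = sum ?F ?G"
    by (rule sum.reindex_bij_witness[where i="\<lambda>(a, a', b, b'). (b, b', a, a')" and j="\<lambda>(a, a', b, b'). (b, b', a, a')"])
      (auto simp: odd_products_def algebra_simps)
  finally show ?thesis using sum_off_diagonal[OF assms(1)] sum_diagonal[OF assms] by simp
qed

section \<open>Representations of a square by three squares\<close>

text \<open>A divisor \<open>d\<close> of \<open>u * v\<close> is written as \<open>a * b\<close>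
  with \<open>a = gcd d u\<close>. Coprimality of \<open>u div a\<close> and \<open>b\<close> says
  that \<open>a\<close> is the whole gcd, which makes the factorization unique even if
  \<open>u\<close> and \<open>v\<close> share factors.\<close>

lemma chi_divisor_sum_mult:
  assumes "0 < u" "0 < v"
  shows "chi_divisor_sum (u * v) =
    (\<Sum>(a, b)\<in>{(a, b). a \<in> pos_divisors u \<and> b \<in> pos_divisors v \<and> coprime (u div a) b}. chi a * chi b)"
  unfolding chi_divisor_sum_def
proof (rule sum.reindex_bij_witness[where j="\<lambda>d. (gcd d u, d div gcd d u)" and i="\<lambda>(a, b). a * b"], goal_cases)
  case (1 d)
  then show ?case by simp
next
  case (2 d)
  then have d: "0 < d" "d dvd u * v" by (auto simp: pos_divisors_def)
  define g where "g = gcd d u"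
  have g: "0 < g" using d by (simp add: g_def)
  obtain d' where d': "d = g * d'" unfolding g_def by (meson gcd_dvd1 dvdE)
  obtain u' where u': "u = g * u'" unfolding g_def by (meson gcd_dvd2 dvdE)
  have e1: "gcd (g * d') (g * u') = g" unfolding d'[symmetric] u'[symmetric] by (simp add: g_def)
  then have "g * gcd d' u' = g" using g gcd_mult_distrib_int[of g d' u'] by simp
  then have cop: "coprime u' d'" using g by (simp add: coprime_iff_gcd_eq_1 gcd.commute)
  have "d' dvd u' * v" using d(2) g unfolding d' u' by (simp add: mult.assoc)
  then have "d' dvd v" using cop by (simp add: coprime_dvd_mult_right_iff coprime_commute)
  moreover have "0 < d'" using d(1) g unfolding d' by (simp add: zero_less_mult_iff)
  ultimately show ?case using g cop u' d' e1 by (simp add: pos_divisors_def)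
next
  case (3 x)
  then obtain a b where x: "x = (a, b)" "0 < a" "a dvd u" "0 < b" "b dvd v" "coprime (u div a) b"
    by (auto simp: pos_divisors_def)
  then obtain u' where u': "u = a * u'" by auto
  have "gcd (a * b) (a * u') = a * gcd b u'" using x(2) gcd_mult_distrib_int[of a b u'] by simp
  also have "gcd b u' = 1" using x u' by (simp add: coprime_iff_gcd_eq_1 gcd.commute)
  finally show ?case using x u' by simp
next
  case (4 x)
  then show ?case by (auto simp: pos_divisors_def mult_dvd_mono)
next
  case (5 d)
  have "chi (gcd d u * (d div gcd d u)) = chi d" by simp
  then show ?case unfolding chi_mult by simp
qed

section \<open>From divisor sums to sums over coprime products\<close>

definition odds_below :: "int \<Rightarrow> int set" where
  "odds_below n = {u. odd u \<and> 0 < u \<and> u < n}"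

definition coprime_odd_products :: "int \<Rightarrow> (int \<times> int \<times> int \<times> int) set" where
  "coprime_odd_products n = {(a, a', b, b')\<in>odd_products n. coprime a' b}"

lemma finite_odds_below: "finite (odds_below n)"
  by (rule finite_subset[of _ "{0..n}"]) (auto simp: odds_below_def)

lemma finite_coprime_odd_products: "finite (coprime_odd_products n)"
  by (rule finite_subset[OF _ finite_odd_products[of n]]) (auto simp: coprime_odd_products_def)

text \<open>With \<open>u = a * a'\<close> and \<open>2 * m - u = b * b'\<close>, the condition
  \<open>coprime (u div a) b\<close> becomes \<open>coprime a' b\<close>.\<close>

lemma sum_chi_divisor_sum:
  "(\<Sum>u\<in>odds_below (2 * m). chi_divisor_sum (u * (2 * m - u)))
    = (\<Sum>(a, a', b, b')\<in>coprime_odd_products (2 * m). chi a * chi b)"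
proof -
  let ?B = "\<lambda>u. {(a, b). a \<in> pos_divisors u \<and> b \<in> pos_divisors (2 * m - u) \<and> coprime (u div a) b}"
  have fin: "finite (?B u)" if "u \<in> odds_below (2 * m)" for u
    by (rule finite_subset[of _ "pos_divisors u \<times> pos_divisors (2 * m - u)"])
      (use that in \<open>auto simp: odds_below_def intro!: finite_pos_divisors\<close>)
  have "(\<Sum>u\<in>odds_below (2 * m). chi_divisor_sum (u * (2 * m - u)))
      = (\<Sum>u\<in>odds_below (2 * m). \<Sum>(a, b)\<in>?B u. chi a * chi b)"
    by (rule sum.cong) (auto simp: odds_below_def intro!: chi_divisor_sum_mult)
  also have "\<dots> = (\<Sum>(u, a, b)\<in>Sigma (odds_below (2 * m)) ?B. chi a * chi b)"
    by (rule sum.Sigma) (use fin in \<open>auto simp: finite_odds_below\<close>)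
  also have "\<dots> = (\<Sum>(a, a', b, b')\<in>coprime_odd_products (2 * m). chi a * chi b)"
  proof (rule sum.reindex_bij_witness[where j="\<lambda>(u, a, b). (a, u div a, b, (2 * m - u) div b)"
        and i="\<lambda>(a, a', b, b'). (a * a', a, b)"], goal_cases)
    case (1 x)
    then show ?case by (auto simp: pos_divisors_def)
  next
    case (2 x)
    then obtain u a b where x: "x = (u, a, b)" "odd u" "0 < u" "u < 2 * m" "0 < a" "a dvd u" "0 < b" "b dvd 2 * m - u" "coprime (u div a) b"
      by (auto simp: pos_divisors_def odds_below_def)
    then obtain a' b' where ab: "u = a * a'" "2 * m - u = b * b'" by (auto elim!: dvdE)
    have "odd (2 * m - u)" "0 < 2 * m - u" using x by auto
    with ab x have "0 < a'" "0 < b'" "odd a" "odd b" "odd a'" "odd b'" by (auto simp: zero_less_mult_iff)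
    moreover have "a * a' + b * b' = 2 * m" using ab by simp
    ultimately show ?case using x ab by (auto simp: coprime_odd_products_def odd_products_def)
  next
    case (3 x)
    then obtain a a' b b' where x: "x = (a, a', b, b')" "0 < a" "0 < b" "a * a' + b * b' = 2 * m"
      by (auto simp: coprime_odd_products_def odd_products_def)
    then have e: "2 * m - a * a' = b * b'" by simp
    have "(2 * m - a * a') div b = b'" unfolding e using x by simp
    then show ?case using x(1,2) by simp
  next
    case (4 x)
    then obtain a a' b b' where x: "x = (a, a', b, b')" "0 < a" "0 < b" "0 < a'" "0 < b'" "a * a' + b * b' = 2 * m"
      "odd a" "odd a'" "coprime a' b"
      by (auto simp: coprime_odd_products_def odd_products_def)
    then have e: "2 * m - a * a' = b * b'" by simp
    have "0 < a * a'" "0 < b * b'" using x by auto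
    then have "a * a' < 2 * m" using e by linarith
    then show ?case using x e \<open>0 < a * a'\<close> by (simp add: pos_divisors_def odds_below_def)
  next
    case (5 x)
    then show ?case by auto
  qed
  finally show ?thesis .
qed

text \<open>The products are sorted by \<open>g = gcd a' b\<close>. Dividing \<open>a'\<close> and
  \<open>b\<close> by \<open>g\<close> leaves a coprime product for \<open>m div g\<close>, and
  \<open>chi b\<close> releases the factor \<open>chi g\<close>. As \<open>g\<close> is odd and
  divides \<open>2 * m\<close>, it divides \<open>m\<close>.\<close>

lemma sum_coprime_odd_products:
  assumes "odd m" "0 < m"
  shows "(\<Sum>g\<in>pos_divisors m. chi g * (\<Sum>(a, a', b, b')\<in>coprime_odd_products (2 * (m div g)). chi a * chi b))
    = (\<Sum>(a, a', b, b')\<in>odd_products (2 * m). chi a * chi b)"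
proof -
  have "(\<Sum>g\<in>pos_divisors m. chi g * (\<Sum>(a, a', b, b')\<in>coprime_odd_products (2 * (m div g)). chi a * chi b))
     = (\<Sum>g\<in>pos_divisors m. \<Sum>(a, a', b, b')\<in>coprime_odd_products (2 * (m div g)). chi g * (chi a * chi b))"
    by (simp add: sum_distrib_left case_prod_unfold)
  also have "\<dots> = (\<Sum>(g, a, a', b, b')\<in>Sigma (pos_divisors m) (\<lambda>g. coprime_odd_products (2 * (m div g))). chi g * (chi a * chi b))"
    by (rule sum.Sigma) (use assms in \<open>auto simp: finite_pos_divisors finite_coprime_odd_products\<close>)
  also have "\<dots> = (\<Sum>(a, a', b, b')\<in>odd_products (2 * m). chi a * chi b)"
  proof (rule sum.reindex_bij_witness[where j="\<lambda>(g, a, a', b, b'). (a, g * a', g * b, b')"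
        and i="\<lambda>(a, a', b, b'). (gcd a' b, a, a' div gcd a' b, b div gcd a' b, b')"], goal_cases)
    case (1 x)
    then obtain g a a' b b' where x: "x = (g, a, a', b, b')" "0 < g" "coprime a' b"
      by (auto simp: coprime_odd_products_def pos_divisors_def)
    have "gcd (g * a') (g * b) = g" using x gcd_mult_distrib_int[of g a' b] by simp
    then show ?case using x by simp
  next
    case (2 x)
    then obtain g a a' b b' where x: "x = (g, a, a', b, b')" "0 < g" "g dvd m" "odd a" "odd a'" "odd b" "odd b'"
      "0 < a" "0 < a'" "0 < b" "0 < b'" "a * a' + b * b' = 2 * (m div g)"
      by (auto simp: coprime_odd_products_def odd_products_def pos_divisors_def)
    have "g * (a * a' + b * b') = 2 * m" unfolding x(12) using x(3) by simp
    moreover have "odd g" using x(3) assms(1) by auto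
    ultimately show ?case using x by (simp add: odd_products_def algebra_simps)
  next
    case (3 x)
    then show ?case by (cases x) simp
  next
    case (4 x)
    then obtain a a' b b' where x: "x = (a, a', b, b')" "odd a" "odd a'" "odd b" "odd b'"
      "0 < a" "0 < a'" "0 < b" "0 < b'" "a * a' + b * b' = 2 * m"
      by (auto simp: odd_products_def)
    define g where "g = gcd a' b"
    have g: "0 < g" using x by (simp add: g_def)
    obtain c where c: "a' = g * c" unfolding g_def by (meson gcd_dvd1 dvdE)
    obtain d where d: "b = g * d" unfolding g_def by (meson gcd_dvd2 dvdE)
    have e2: "gcd (g * c) (g * d) = g" unfolding c[symmetric] d[symmetric] by (simp add: g_def)
    then have "g * gcd c d = g" using g gcd_mult_distrib_int[of g c d] by simp
    then have cop: "coprime c d" using g by (simp add: coprime_iff_gcd_eq_1)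
    have e: "2 * m = g * (a * c + d * b')" using x(10) unfolding c d by (simp add: algebra_simps)
    have odd: "odd g" "odd c" "odd d" using x c d by auto
    have "coprime g 2" using odd by simp
    moreover have "g dvd 2 * m" unfolding e by simp
    ultimately have "g dvd m" by (simp add: coprime_dvd_mult_right_iff)
    then obtain k where k: "m = g * k" by auto
    have "a * c + d * b' = 2 * k" using e g unfolding k by simp
    moreover have "0 < c" "0 < d" using x g c d by (auto simp: zero_less_mult_iff)
    ultimately show ?case using x g odd cop k c d e2
      by (simp add: coprime_odd_products_def odd_products_def pos_divisors_def)
  next
    case (5 x)
    then show ?case by (auto simp: chi_mult)
  qed
  finally show ?thesis .
qed

text \<open>The solutions are sliced by \<open>u = m - z\<close>. Since \<open>m\<close> is odd and
  \<open>z\<close> even, \<open>\<bar>z\<bar> < m\<close>, and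
  \<open>x^2 + y^2 = u * (2 * m - u)\<close> is 1 modulo 4, so the two-squares formula
  applies.\<close>

lemma card_even_three_squares:
  assumes "odd m" "0 < m"
  shows "int (card {(x, y, z)\<in>three_squares (m\<^sup>2). even z}) = 4 * (\<Sum>u\<in>odds_below (2 * m). chi_divisor_sum (u * (2 * m - u)))"
proof -
  have "card {(x, y, z)\<in>three_squares (m\<^sup>2). even z} = card (Sigma (odds_below (2 * m)) (\<lambda>u. two_squares (u * (2 * m - u))))"
  proof (rule bij_betw_same_card, rule bij_betw_byWitness[where f="\<lambda>(x, y, z). (m - z, x, y)" and f'="\<lambda>(u, x, y). (x, y, m - u)"])
    show "(\<lambda>(x, y, z). (m - z, x, y)) ` {(x, y, z)\<in>three_squares (m\<^sup>2). even z} \<subseteq> Sigma (odds_below (2 * m)) (\<lambda>u. two_squares (u * (2 * m - u)))"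
    proof clarify
      fix x y z assume h: "(x, y, z) \<in> three_squares (m\<^sup>2)" "even z"
      then have e: "x\<^sup>2 + y\<^sup>2 + z\<^sup>2 = m\<^sup>2" by (simp add: three_squares_def)
      then have "z\<^sup>2 \<le> m\<^sup>2" using zero_le_power2[of x] zero_le_power2[of y] by linarith
      then have "\<bar>z\<bar> \<le> m" using assms by (metis abs_le_square_iff abs_of_pos)
      moreover have "\<bar>z\<bar> \<noteq> m" using h(2) assms(1) by auto
      ultimately have "m - z \<in> odds_below (2 * m)" using h assms by (auto simp: odds_below_def)
      moreover have "(x, y) \<in> two_squares ((m - z) * (2 * m - (m - z)))"
        using e by (simp add: two_squares_def power2_eq_square algebra_simps)
      ultimately show "m - z \<in> odds_below (2 * m) \<and> (x, y) \<in> two_squares ((m - z) * (2 * m - (m - z)))" by simp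
    qed
  qed (use assms in \<open>auto simp: odds_below_def two_squares_def three_squares_def power2_eq_square algebra_simps\<close>)
  also have "int \<dots> = (\<Sum>u\<in>odds_below (2 * m). int (card (two_squares (u * (2 * m - u)))))"
    by (simp add: finite_odds_below finite_two_squares)
  also have "\<dots> = (\<Sum>u\<in>odds_below (2 * m). 4 * chi_divisor_sum (u * (2 * m - u)))"
  proof (rule sum.cong[OF refl], rule card_two_squares_odd)
    fix u assume u: "u \<in> odds_below (2 * m)"
    then show "0 < u * (2 * m - u)" by (auto simp: odds_below_def)
    obtain i j where ij: "u = 2 * i + 1" "m = 2 * j + 1" using u assms by (auto simp: odds_below_def elim!: oddE)
    \<comment> \<open>Expanding \<open>(2 * i + 1) * (4 * j - 2 * i + 1)\<close> gives 1 plus 4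
      times this \<open>k\<close>.\<close>
    obtain k where k: "k = 2 * i * j - i * i + j" by blast
    have "u * (2 * m - u) = 4 * k + 1" unfolding ij k by (simp add: algebra_simps)
    then show "u * (2 * m - u) mod 4 = 1" by simp
  qed
  finally show ?thesis by (simp add: sum_distrib_left)
qed

text \<open>As \<open>m^2\<close> is 1 modulo 4, exactly one coordinate is odd. By symmetry
  \<open>z\<close> is even in two thirds of the solutions, so the factor 4 becomes 6.\<close>

lemma card_three_squares_odd_square:
  assumes "odd m" "0 < m"
  shows "int (card (three_squares (m\<^sup>2))) = 6 * (\<Sum>(a, a', b, b')\<in>coprime_odd_products (2 * m). chi a * chi b)"
proof -
  let ?T = "three_squares (m\<^sup>2)"
  let ?X = "{(x, y, z)\<in>?T. odd x}" and ?Y = "{(x, y, z)\<in>?T. odd y}" and ?Z = "{(x, y, z)\<in>?T. odd z}"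
  let ?E = "{(x, y, z)\<in>?T. even z}"
  have fin: "finite ?X" "finite ?Y" "finite ?Z" "finite ?E"
    by (auto intro: finite_subset[OF _ finite_three_squares[of "m\<^sup>2"]])
  have one: "odd x \<and> even y \<and> even z \<or> even x \<and> odd y \<and> even z \<or> even x \<and> even y \<and> odd z"
    if "(x, y, z) \<in> ?T" for x y z
  proof -
    have e: "x\<^sup>2 + y\<^sup>2 + z\<^sup>2 = m\<^sup>2" using that by (simp add: three_squares_def)
    show ?thesis using three_squares_mod4[of x y z] square_mod4[of m] assms(1)
      unfolding e by (auto simp: of_bool_def split: if_splits)
  qed
  have "?T = ?X \<union> (?Y \<union> ?Z)" using one by fastforce
  then have "card ?T = card (?X \<union> (?Y \<union> ?Z))" by simp
  also have "\<dots> = card ?X + card (?Y \<union> ?Z)" by (rule card_Un_disjoint) (use fin one in auto)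
  also have "card (?Y \<union> ?Z) = card ?Y + card ?Z" by (rule card_Un_disjoint) (use fin one in auto)
  finally have 1: "card ?T = card ?X + (card ?Y + card ?Z)" .
  have 2: "card ?X = card ?Z"
    by (rule bij_betw_same_card[of "\<lambda>(x, y, z). (z, y, x)"], rule bij_betw_byWitness[where f'="\<lambda>(x, y, z). (z, y, x)"])
      (auto simp: three_squares_def)
  have 3: "card ?Y = card ?Z"
    by (rule bij_betw_same_card[of "\<lambda>(x, y, z). (x, z, y)"], rule bij_betw_byWitness[where f'="\<lambda>(x, y, z). (x, z, y)"])
      (auto simp: three_squares_def)
  have "?T = ?E \<union> ?Z" by fastforce
  then have "card ?T = card (?E \<union> ?Z)" by simp
  also have "\<dots> = card ?E + card ?Z" by (rule card_Un_disjoint) (use fin in auto)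
  finally have "2 * card ?T = 3 * card ?E" using 1 2 3 by simp
  then have "2 * int (card ?T) = 3 * int (card ?E)" by linarith
  then show ?thesis using card_even_three_squares[OF assms] sum_chi_divisor_sum[of m] by simp
qed

text \<open>Summing over \<open>g\<close> with weight \<open>chi g\<close> removes the coprimality
  condition, so that Dirichlet's sum applies. The left side is a Dirichlet convolution, inverted
  below.\<close>

theorem sum_chi_three_squares:
  assumes "odd m" "0 < m"
  shows "(\<Sum>g\<in>pos_divisors m. chi g * int (card (three_squares ((m div g)\<^sup>2)))) = 6 * (\<Sum>d\<in>pos_divisors m. d)"
proof -
  have "(\<Sum>g\<in>pos_divisors m. chi g * int (card (three_squares ((m div g)\<^sup>2))))
    = (\<Sum>g\<in>pos_divisors m. 6 * (chi g * (\<Sum>(a, a', b, b')\<in>coprime_odd_products (2 * (m div g)). chi a * chi b)))"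
  proof (rule sum.cong[OF refl])
    fix g assume "g \<in> pos_divisors m"
    then obtain k where k: "m = g * k" "0 < g" by (auto simp: pos_divisors_def)
    then have "odd k" "0 < k" using assms by (auto simp: zero_less_mult_iff)
    from card_three_squares_odd_square[OF this]
    show "chi g * int (card (three_squares ((m div g)\<^sup>2))) = 6 * (chi g * (\<Sum>(a, a', b, b')\<in>coprime_odd_products (2 * (m div g)). chi a * chi b))"
      using k by simp
  qed
  also have "\<dots> = 6 * (\<Sum>g\<in>pos_divisors m. (chi g * (\<Sum>(a, a', b, b')\<in>coprime_odd_products (2 * (m div g)). chi a * chi b)))"
    by (simp add: sum_distrib_left)
  finally show ?thesis unfolding sum_coprime_odd_products[OF assms] sum_odd_products[OF assms] .
qed

section \<open>Primitive representations\<close>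

definition dirichlet_conv :: "(nat \<Rightarrow> 'a) \<Rightarrow> (nat \<Rightarrow> 'a) \<Rightarrow> nat \<Rightarrow> 'a :: comm_semiring_1" where
  "dirichlet_conv f g n = (\<Sum>d | d dvd n. f d * g (n div d))"

text \<open>Both sides run over the factorizations of \<open>n\<close> into three factors.\<close>

lemma dirichlet_conv_assoc:
  assumes "0 < n"
  shows "dirichlet_conv f (dirichlet_conv g h) n = dirichlet_conv (dirichlet_conv f g) h n"
proof -
  have fin: "finite {d. d dvd m}" if "m dvd n" for m
    using that assms by (auto intro: finite_divisors_nat dvd_pos_nat)
  have "dirichlet_conv f (dirichlet_conv g h) n
     = (\<Sum>d | d dvd n. \<Sum>e | e dvd n div d. f d * (g e * h (n div d div e)))"
    by (simp add: dirichlet_conv_def sum_distrib_left)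
  also have "\<dots> = (\<Sum>(d, e)\<in>Sigma {d. d dvd n} (\<lambda>d. {e. e dvd n div d}). f d * (g e * h (n div d div e)))"
    by (rule sum.Sigma) (auto intro!: fin simp: div_dvd_iff_mult dvd_div_iff_mult)
  also have "\<dots> = (\<Sum>(k, d)\<in>Sigma {k. k dvd n} (\<lambda>k. {d. d dvd k}). f d * g (k div d) * h (n div k))"
  proof (rule sum.reindex_bij_witness[where j="\<lambda>(d, e). (d * e, d)" and i="\<lambda>(k, d). (d, k div d)"], goal_cases)
    case (1 x)
    then show ?case using assms by (auto simp: dvd_pos_nat)
  next
    case (2 x)
    then obtain d e k where "x = (d, e)" "n = d * k" "e dvd k" using assms by (auto elim!: dvdE)
    then show ?case by auto
  next
    case (3 x)
    then show ?case by auto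
  next
    case (4 x)
    then obtain d c e where x: "x = (d * c, d)" "n = (d * c) * e" by (auto elim!: dvdE)
    with assms have "0 < d" by auto
    with x show ?case by (auto simp: mult.assoc)
  next
    case (5 x)
    then obtain d e where "x = (d, e)" "d dvd n" by auto
    with assms have "0 < d" by (auto simp: dvd_pos_nat)
    then show ?case using \<open>x = (d, e)\<close> by (simp add: div_mult2_eq mult.assoc)
  qed
  also have "\<dots> = (\<Sum>k | k dvd n. \<Sum>d | d dvd k. f d * g (k div d) * h (n div k))"
    by (rule sum.Sigma[symmetric]) (auto intro!: fin)
  also have "\<dots> = dirichlet_conv (dirichlet_conv f g) h n"
    by (simp add: dirichlet_conv_def sum_distrib_right)
  finally show ?thesis .
qed

lemma dirichlet_conv_commute:
  assumes "0 < n"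
  shows "dirichlet_conv f g n = dirichlet_conv g f n"
  unfolding dirichlet_conv_def
  by (rule sum.reindex_bij_witness[where i="\<lambda>d. n div d" and j="\<lambda>d. n div d"])
    (use assms in \<open>auto simp: mult.commute elim!: dvdE\<close>)

lemma dirichlet_conv_cong:
  assumes "\<And>d. d dvd n \<Longrightarrow> f d = f' d" "\<And>d. d dvd n \<Longrightarrow> g d = g' d"
  shows "dirichlet_conv f g n = dirichlet_conv f' g' n"
  unfolding dirichlet_conv_def
  by (rule sum.cong) (auto simp: assms div_dvd_iff_mult elim!: dvdE)

lemma dirichlet_conv_delta:
  assumes "0 < n"
  shows "dirichlet_conv (\<lambda>n. if n = 1 then 1 else 0) f n = f n"
proof -
  have "dirichlet_conv (\<lambda>n. if n = 1 then 1 else 0) f n = (\<Sum>d | d dvd n. if d = 1 then f n else 0)"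
    unfolding dirichlet_conv_def by (rule sum.cong) auto
  also have "\<dots> = f n" using assms by (subst sum.delta) auto
  finally show ?thesis .
qed

section \<open>The Moebius function and its twist by the character\<close>

definition moebius :: "nat \<Rightarrow> int" where
  "moebius n = (if squarefree n then (-1) ^ card (prime_factors n) else 0)"

lemma abs_moebius_le: "\<bar>moebius n\<bar> \<le> 1"
  by (simp add: moebius_def)

lemma moebius_prime_mult:
  assumes "prime p" "\<not> p dvd d"
  shows "moebius (p * d) = - moebius d"
proof (cases "squarefree d")
  case True
  then have "d \<noteq> 0" by (metis not_squarefree_0)
  have "coprime p d" using assms by (simp add: prime_imp_coprime)
  then have "squarefree (p * d)" using True assms(1) by (intro squarefree_mult_coprime) (auto intro: squarefree_prime)
  moreover have "prime_factors (p * d) = insert p (prime_factors d)"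
    using \<open>d \<noteq> 0\<close> assms by (subst prime_factors_product) (auto simp: prime_prime_factors)
  moreover have "p \<notin> prime_factors d" using assms by auto
  ultimately show ?thesis using True by (simp add: moebius_def)
next
  case False
  then have "\<not> squarefree (p * d)" by (meson squarefree_mono dvd_triv_right)
  with False show ?thesis by (simp add: moebius_def)
qed

text \<open>For a prime \<open>p\<close> dividing \<open>n\<close>, the divisors \<open>d\<close>
  prime to \<open>p\<close> cancel against \<open>p * d\<close>; the remaining divisors are
  multiples of \<open>p^2\<close> and contribute zero.\<close>

lemma sum_moebius:
  assumes "0 < n"
  shows "(\<Sum>d | d dvd n. moebius d) = (if n = 1 then 1 else 0)"
proof (cases "n = 1")
  case True
  then show ?thesis by (simp add: moebius_def)
next
  case False
  then obtain p where p: "prime p" "p dvd n" using prime_factor_nat[of n] by auto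
  let ?A = "{d. d dvd n \<and> \<not> p dvd d}" and ?B = "{d. d dvd n \<and> p dvd d}"
  have fin: "finite {d. d dvd n}" using assms by simp
  have "{d. d dvd n} = ?A \<union> ?B" by auto
  then have "(\<Sum>d | d dvd n. moebius d) = sum moebius (?A \<union> ?B)" by (rule arg_cong)
  also have "\<dots> = sum moebius ?A + sum moebius ?B"
    by (rule sum.union_disjoint) (use fin in auto)
  also have "sum moebius ?B = sum moebius ((\<lambda>d. p * d) ` ?A)"
  proof (rule sum.mono_neutral_right)
    show "(\<lambda>d. p * d) ` ?A \<subseteq> ?B"
    proof clarify
      fix d assume "d dvd n" "\<not> p dvd d"
      moreover from this p(1) have "coprime p d" by (simp add: prime_imp_coprime)
      ultimately show "p * d dvd n \<and> p dvd p * d" using p(2) by (simp add: divides_mult)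
    qed
    show "\<forall>d\<in>?B - (\<lambda>d. p * d) ` ?A. moebius d = 0"
    proof
      fix d assume d: "d \<in> ?B - (\<lambda>d. p * d) ` ?A"
      then obtain e where e: "d = p * e" by auto
      have "e dvd n" using d unfolding e by (auto dest: dvd_mult_right)
      then have "p dvd e" using d unfolding e by blast
      then have "p ^ 2 dvd d" unfolding e power2_eq_square by simp
      then have "\<not> squarefree d" using p(1) not_prime_unit[of p] by (intro not_squarefreeI) auto
      then show "moebius d = 0" by (simp add: moebius_def)
    qed
  qed (use fin in auto)
  also have "\<dots> = (\<Sum>d\<in>?A. moebius (p * d))"
    by (subst sum.reindex) (use p(1) in \<open>auto simp: inj_on_def prime_gt_0_nat\<close>)
  also have "\<dots> = (\<Sum>d\<in>?A. - moebius d)"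
    by (rule sum.cong) (use p(1) in \<open>auto simp: moebius_prime_mult\<close>)
  finally show ?thesis using False by (simp add: sum_negf)
qed

text \<open>The inverse of \<open>chi\<close> under convolution, as \<open>chi\<close> is completely
  multiplicative.\<close>

definition moebius_chi :: "nat \<Rightarrow> int" where
  "moebius_chi n = moebius n * chi (int n)"

lemma abs_moebius_chi_le: "\<bar>moebius_chi n\<bar> \<le> 1"
  using mult_mono[OF abs_moebius_le[of n] abs_chi_le[of "int n"]] by (simp add: moebius_chi_def abs_mult)

lemma moebius_chi_conv:
  assumes "0 < n"
  shows "dirichlet_conv moebius_chi (\<lambda>n. chi (int n)) n = (if n = 1 then 1 else 0)"
proof -
  have "dirichlet_conv moebius_chi (\<lambda>n. chi (int n)) n = (\<Sum>d | d dvd n. moebius d * chi (int n))"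
    unfolding dirichlet_conv_def
  proof (rule sum.cong[OF refl])
    fix d assume "d \<in> {d. d dvd n}"
    then have "int n = int d * int (n div d)" by (simp flip: of_nat_mult)
    then have "chi (int n) = chi (int d) * chi (int (n div d))" by (metis chi_mult)
    then show "moebius_chi d * chi (int (n div d)) = moebius d * chi (int n)"
      by (simp add: moebius_chi_def)
  qed
  also have "\<dots> = (\<Sum>d | d dvd n. moebius d) * chi (int n)" by (simp add: sum_distrib_right)
  finally show ?thesis using sum_moebius[OF assms] by simp
qed

text \<open>The gcd includes \<open>m\<close>, so it is that of the Lorentz quadruple with first
  entry \<open>m\<close>. For \<open>m = 0\<close> it is 0 and the set is empty.\<close>

definition primitive_triples :: "nat \<Rightarrow> (int \<times> int \<times> int) set" where
  "primitive_triples m = {(x, y, z)\<in>three_squares ((int m)\<^sup>2). gcd (int m) (gcd x (gcd y z)) = 1}"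

lemma finite_primitive_triples: "finite (primitive_triples m)"
  by (rule finite_subset[OF _ finite_three_squares[of "(int m)\<^sup>2"]]) (auto simp: primitive_triples_def)

text \<open>Three squares whose sum is divisible by 4 are all even, so 2 is a common factor.\<close>

lemma primitive_triples_even:
  assumes "even m"
  shows "primitive_triples m = {}"
proof -
  have "gcd (int m) (gcd x (gcd y z)) \<noteq> 1" if "(x, y, z) \<in> three_squares ((int m)\<^sup>2)" for x y z
  proof -
    have e: "x\<^sup>2 + y\<^sup>2 + z\<^sup>2 = (int m)\<^sup>2" using that by (simp add: three_squares_def)
    have "even x" "even y" "even z" using three_squares_mod4[of x y z] square_mod4[of "int m"] assms
      unfolding e by (auto simp: of_bool_def split: if_splits)
    then have "2 dvd gcd (int m) (gcd x (gcd y z))" using assms by simp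
    then show ?thesis by auto
  qed
  then show ?thesis unfolding primitive_triples_def by auto
qed

text \<open>Dividing a solution by the common gcd \<open>g\<close> leaves a primitive triple for
  \<open>n div g\<close>.\<close>

lemma card_three_squares_eq_sum:
  assumes "0 < n"
  shows "card (three_squares ((int n)\<^sup>2)) = (\<Sum>g | g dvd n. card (primitive_triples (n div g)))"
proof -
  have "card (three_squares ((int n)\<^sup>2)) = card (Sigma {g. g dvd n} (\<lambda>g. primitive_triples (n div g)))"
  proof (rule bij_betw_same_card, rule bij_betw_byWitness[where
      f="\<lambda>(x, y, z). let g = gcd (int n) (gcd x (gcd y z)) in (nat g, x div g, y div g, z div g)" and
      f'="\<lambda>(g, x, y, z). (int g * x, int g * y, int g * z)"])
    have *: "\<exists>k a b c. n = g * k \<and> x = int g * a \<and> y = int g * b \<and> z = int g * c \<and> 0 < g \<and> (a, b, c) \<in> primitive_triples k"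
      if "x\<^sup>2 + y\<^sup>2 + z\<^sup>2 = (int n)\<^sup>2" and g: "g = nat (gcd (int n) (gcd x (gcd y z)))" for x y z g
    proof -
      have ig: "int g = gcd (int n) (gcd x (gcd y z))" using g by simp
      have "0 < gcd (int n) (gcd x (gcd y z))" using assms by simp
      then have g0: "0 < g" unfolding g by simp
      have "int g dvd int n" "int g dvd x" "int g dvd y" "int g dvd z"
        unfolding ig by (auto intro: dvd_trans)
      then obtain k a b c where k: "n = g * k" "x = int g * a" "y = int g * b" "z = int g * c"
        by (auto elim!: dvdE)
      have "int g * gcd (int k) (gcd a (gcd b c)) = int g"
        using ig[symmetric] unfolding k by (simp add: gcd_mult_left)
      then have "gcd (int k) (gcd a (gcd b c)) = 1" using g0 by simp
      moreover have "(int g)\<^sup>2 * (a\<^sup>2 + b\<^sup>2 + c\<^sup>2) = (int g)\<^sup>2 * (int k)\<^sup>2"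
        using that(1) unfolding k by (simp add: algebra_simps power_mult_distrib)
      then have "a\<^sup>2 + b\<^sup>2 + c\<^sup>2 = (int k)\<^sup>2" using g0 by simp
      ultimately show ?thesis using k g0 by (auto simp: primitive_triples_def three_squares_def)
    qed
    show "\<forall>a\<in>three_squares ((int n)\<^sup>2). (\<lambda>(g, x, y, z). (int g * x, int g * y, int g * z))
       ((\<lambda>(x, y, z). let g = gcd (int n) (gcd x (gcd y z)) in (nat g, x div g, y div g, z div g)) a) = a"
    proof -
      have "gcd (int n) (gcd x (gcd y z)) dvd x" "gcd (int n) (gcd x (gcd y z)) dvd y" "gcd (int n) (gcd x (gcd y z)) dvd z" for x y z
        by (meson gcd_dvd1 gcd_dvd2 dvd_trans)+
      then show ?thesis by (auto simp: Let_def)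
    qed
    show "(\<lambda>(x, y, z). let g = gcd (int n) (gcd x (gcd y z)) in (nat g, x div g, y div g, z div g)) `
      three_squares ((int n)\<^sup>2) \<subseteq> Sigma {g. g dvd n} (\<lambda>g. primitive_triples (n div g))"
    proof
      fix t assume "t \<in> (\<lambda>(x, y, z). let g = gcd (int n) (gcd x (gcd y z)) in (nat g, x div g, y div g, z div g)) ` three_squares ((int n)\<^sup>2)"
      then obtain x y z g where t: "t = (g, x div int g, y div int g, z div int g)" "g = nat (gcd (int n) (gcd x (gcd y z)))"
        "x\<^sup>2 + y\<^sup>2 + z\<^sup>2 = (int n)\<^sup>2"
        by (auto simp: Let_def three_squares_def)
      from *[OF t(3,2)] show "t \<in> Sigma {g. g dvd n} (\<lambda>g. primitive_triples (n div g))"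
        unfolding t(1) by auto
    qed
    have **: "x\<^sup>2 + y\<^sup>2 + z\<^sup>2 = (int k)\<^sup>2 \<and> gcd (int k) (gcd x (gcd y z)) = 1"
      if "(x, y, z) \<in> primitive_triples k" for x y z k
      using that by (auto simp: primitive_triples_def three_squares_def)
    have ***: "gcd (int (g * k)) (gcd (int g * x) (gcd (int g * y) (int g * z))) = int g"
      if "(x, y, z) \<in> primitive_triples k" for x y z k g
      using **[OF that] by (simp add: gcd_mult_left)
    show "\<forall>a\<in>Sigma {g. g dvd n} (\<lambda>g. primitive_triples (n div g)). (\<lambda>(x, y, z). let g = gcd (int n) (gcd x (gcd y z)) in (nat g, x div g, y div g, z div g))
      ((\<lambda>(g, x, y, z). (int g * x, int g * y, int g * z)) a) = a"
    proof
      fix t assume "t \<in> Sigma {g. g dvd n} (\<lambda>g. primitive_triples (n div g))"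
      then obtain g k x y z where t: "t = (g, x, y, z)" "n = g * k" "(x, y, z) \<in> primitive_triples k"
        using assms by (auto elim!: dvdE)
      then have "0 < g" using assms by simp
      then show "(\<lambda>(x, y, z). let g = gcd (int n) (gcd x (gcd y z)) in (nat g, x div g, y div g, z div g))
        ((\<lambda>(g, x, y, z). (int g * x, int g * y, int g * z)) t) = t"
        using ***[OF t(3), of g] unfolding t(1,2) by (simp add: Let_def)
    qed
    show "(\<lambda>(g, x, y, z). (int g * x, int g * y, int g * z)) ` Sigma {g. g dvd n} (\<lambda>g. primitive_triples (n div g)) \<subseteq> three_squares ((int n)\<^sup>2)"
    proof
      fix s assume "s \<in> (\<lambda>(g, x, y, z). (int g * x, int g * y, int g * z)) ` Sigma {g. g dvd n} (\<lambda>g. primitive_triples (n div g))"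
      then obtain g k x y z where t: "s = (int g * x, int g * y, int g * z)" "n = g * k" "(x, y, z) \<in> primitive_triples k"
        using assms by (auto elim!: dvdE)
      have "(int g)\<^sup>2 * (x\<^sup>2 + y\<^sup>2 + z\<^sup>2) = (int g)\<^sup>2 * (int k)\<^sup>2" using **[OF t(3)] by simp
      then show "s \<in> three_squares ((int n)\<^sup>2)"
        unfolding t(1,2) by (simp add: three_squares_def algebra_simps power_mult_distrib)
    qed
  qed
  also have "\<dots> = (\<Sum>g | g dvd n. card (primitive_triples (n div g)))"
    using assms by (intro card_SigmaI) (auto simp: finite_primitive_triples)
  finally show ?thesis .
qed

lemma sum_pos_divisors:
  assumes "0 < n"
  shows "(\<Sum>d\<in>pos_divisors (int n). F d) = (\<Sum>d | d dvd n. F (int d))"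
  by (rule sum.reindex_bij_witness[where i=int and j=nat])
    (use assms in \<open>auto simp: pos_divisors_def nat_dvd_iff dvd_pos_nat\<close>)

text \<open>Let \<open>P\<close> and \<open>R\<close> be the primitive and the full counts.
  \<open>R\<close> is the convolution of 1 with \<open>P\<close>, and \<open>chi\<close> convolved
  with \<open>R\<close> is 1 convolved with \<open>6 * n\<close>. Now \<open>moebius_chi\<close>
  solves the second equation for \<open>R\<close>, \<open>moebius\<close> solves the first for
  \<open>P\<close>, and this \<open>moebius\<close> cancels the remaining 1. The second equation is
  known at odd arguments, whose divisors are odd again.\<close>

theorem card_primitive_triples:
  assumes "odd n"
  shows "int (card (primitive_triples n)) = 6 * (\<Sum>d | d dvd n. moebius_chi d * int (n div d))"
proof -
  define P where "P = (\<lambda>n. int (card (primitive_triples n)))"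
  define X where "X = (\<lambda>n. chi (int n))"
  define R where "R = (\<lambda>n. int (card (three_squares ((int n)\<^sup>2))))"
  have R: "R n = dirichlet_conv (\<lambda>_. 1) P n" if "0 < n" for n
    unfolding R_def card_three_squares_eq_sum[OF that] dirichlet_conv_def P_def by simp
  have XR: "dirichlet_conv X R n = dirichlet_conv (\<lambda>_. 1) (\<lambda>n. 6 * int n) n" if "odd n" for n
  proof -
    have n: "0 < n" "odd (int n)" "0 < int n" using that by (auto elim: oddE)
    have "dirichlet_conv X R n = (\<Sum>d\<in>pos_divisors (int n). chi d * int (card (three_squares ((int n div d)\<^sup>2))))"
      unfolding dirichlet_conv_def X_def R_def sum_pos_divisors[OF n(1)] by (simp add: of_nat_div)
    also have "\<dots> = (\<Sum>d | d dvd n. 6 * int d)"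
      unfolding sum_chi_three_squares[OF n(2,3)] sum_pos_divisors[OF n(1)] by (simp add: sum_distrib_left)
    also have "\<dots> = dirichlet_conv (\<lambda>n. 6 * int n) (\<lambda>_. 1) n"
      by (simp add: dirichlet_conv_def)
    also have "\<dots> = dirichlet_conv (\<lambda>_. 1) (\<lambda>n. 6 * int n) n"
      using n(1) by (rule dirichlet_conv_commute)
    finally show ?thesis .
  qed
  have pos: "0 < n" if "odd n" for n :: nat using that by (auto elim: oddE)
  have P1: "P n = dirichlet_conv moebius R n" if "odd n" for n
  proof -
    have "dirichlet_conv moebius R n = dirichlet_conv moebius (dirichlet_conv (\<lambda>_. 1) P) n"
      by (rule dirichlet_conv_cong) (use pos[OF that] in \<open>auto intro!: R simp: dvd_pos_nat\<close>)
    also have "\<dots> = dirichlet_conv (dirichlet_conv moebius (\<lambda>_. 1)) P n"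
      using pos[OF that] by (rule dirichlet_conv_assoc)
    also have "\<dots> = dirichlet_conv (\<lambda>n. if n = 1 then 1 else 0) P n"
    proof (rule dirichlet_conv_cong)
      fix d assume "d dvd n"
      then have "0 < d" using pos[OF that] by (auto simp: dvd_pos_nat)
      then show "dirichlet_conv moebius (\<lambda>_. 1) d = (if d = 1 then 1 else 0)"
        using sum_moebius[of d] by (simp add: dirichlet_conv_def)
    qed auto
    finally show ?thesis using dirichlet_conv_delta[OF pos[OF that], of P] by simp
  qed
  have R1: "R n = dirichlet_conv moebius_chi (dirichlet_conv (\<lambda>_. 1) (\<lambda>n. 6 * int n)) n" if "odd n" for n
  proof -
    have "R n = dirichlet_conv (\<lambda>n. if n = 1 then 1 else 0) R n"
      using dirichlet_conv_delta[OF pos[OF that], of R] by simp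
    also have "\<dots> = dirichlet_conv (dirichlet_conv moebius_chi X) R n"
      by (rule dirichlet_conv_cong) (use pos[OF that] in \<open>auto simp: moebius_chi_conv X_def dvd_pos_nat\<close>)
    also have "\<dots> = dirichlet_conv moebius_chi (dirichlet_conv X R) n"
      using pos[OF that] by (rule dirichlet_conv_assoc[symmetric])
    also have "\<dots> = dirichlet_conv moebius_chi (dirichlet_conv (\<lambda>_. 1) (\<lambda>n. 6 * int n)) n"
      by (rule dirichlet_conv_cong) (use that in \<open>auto intro!: XR elim: dvd_trans[rotated]\<close>)
    finally show ?thesis .
  qed
  note n = pos[OF assms]
  let ?I = "\<lambda>n. 6 * int n"
  have "P n = dirichlet_conv moebius (dirichlet_conv moebius_chi (dirichlet_conv (\<lambda>_. 1) ?I)) n"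
    unfolding P1[OF assms] by (rule dirichlet_conv_cong) (use assms in \<open>auto intro!: R1 elim: dvd_trans[rotated]\<close>)
  \<comment> \<open>Moving \<open>moebius_chi\<close> to the end brings the constant 1 next to
    \<open>moebius\<close>.\<close>
  also have "\<dots> = dirichlet_conv moebius (dirichlet_conv (\<lambda>_. 1) (dirichlet_conv ?I moebius_chi)) n"
  proof (rule dirichlet_conv_cong)
    fix d assume "d dvd n"
    then have d: "0 < d" using n by (auto simp: dvd_pos_nat)
    show "dirichlet_conv moebius_chi (dirichlet_conv (\<lambda>_. 1) ?I) d = dirichlet_conv (\<lambda>_. 1) (dirichlet_conv ?I moebius_chi) d"
      unfolding dirichlet_conv_commute[OF d, of moebius_chi] by (rule dirichlet_conv_assoc[OF d, symmetric])
  qed auto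
  also have "\<dots> = dirichlet_conv (dirichlet_conv moebius (\<lambda>_. 1)) (dirichlet_conv ?I moebius_chi) n"
    using n by (rule dirichlet_conv_assoc)
  also have "\<dots> = dirichlet_conv (\<lambda>n. if n = 1 then 1 else 0) (dirichlet_conv ?I moebius_chi) n"
  proof (rule dirichlet_conv_cong)
    fix d assume "d dvd n"
    then have "0 < d" using n by (auto simp: dvd_pos_nat)
    then show "dirichlet_conv moebius (\<lambda>_. 1) d = (if d = 1 then 1 else 0)"
      using sum_moebius[of d] by (simp add: dirichlet_conv_def)
  qed auto
  also have "\<dots> = dirichlet_conv ?I moebius_chi n" by (rule dirichlet_conv_delta[OF n])
  also have "\<dots> = dirichlet_conv moebius_chi ?I n" by (rule dirichlet_conv_commute[OF n])
  finally show ?thesis unfolding P_def dirichlet_conv_def by (simp add: sum_distrib_left algebra_simps)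
qed

section \<open>Summation over the square root\<close>

text \<open>Both sides run over the pairs of positive numbers with
  \<open>d * k \<le> N\<close>.\<close>

lemma sum_divisors_hyperbola:
  fixes F :: "nat \<Rightarrow> nat \<Rightarrow> 'a :: comm_monoid_add"
  shows "(\<Sum>n=1..N. \<Sum>d | d dvd n. F d (n div d)) = (\<Sum>d=1..N. \<Sum>k=1..N div d. F d k)"
proof -
  have "(\<Sum>n=1..N. \<Sum>d | d dvd n. F d (n div d)) = (\<Sum>(n, d)\<in>Sigma {1..N} (\<lambda>n. {d. d dvd n}). F d (n div d))"
    by (rule sum.Sigma) auto
  also have "\<dots> = (\<Sum>(d, k)\<in>Sigma {1..N} (\<lambda>d. {1..N div d}). F d k)"
  proof (rule sum.reindex_bij_witness[where j="\<lambda>(n, d). (d, n div d)" and i="\<lambda>(d, k). (d * k, d)"], goal_cases)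
    case (1 x)
    then show ?case by auto
  next
    case (2 x)
    then obtain d k where x: "x = (d * k, d)" "1 \<le> d * k" "d * k \<le> N" by (auto elim!: dvdE)
    then have "0 < d" "0 < k" by (auto simp: Suc_le_eq)
    moreover from this have "k \<le> N div d" using x by (simp add: less_eq_div_iff_mult_less_eq mult.commute)
    moreover have "d \<le> d * k" using \<open>0 < k\<close> by simp
    then have "d \<le> N" using x(3) by linarith
    ultimately show ?case using x by auto
  next
    case (3 x)
    then show ?case by auto
  next
    case (4 x)
    then obtain d k where x: "x = (d, k)" "0 < d" "0 < k" "k \<le> N div d" by auto
    then have "d * k \<le> N" by (simp add: less_eq_div_iff_mult_less_eq mult.commute)
    then show ?case using x by simp
  next
    case (5 x)
    then show ?case by auto
  qed
  also have "\<dots> = (\<Sum>d=1..N. \<Sum>k=1..N div d. F d k)" by (rule sum.Sigma[symmetric]) auto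
  finally show ?thesis .
qed

lemma sum_odds:
  "(\<Sum>j=1..k. if odd j then real j else 0) = (if even k then (real k)\<^sup>2 / 4 else (real k + 1)\<^sup>2 / 4)"
  by (induction k) (auto simp: power2_eq_square field_simps)

lemma real_div_bounds:
  assumes "1 \<le> d" "d \<le> N"
  shows "real (N div d) \<le> real N / real d" "\<bar>(real (N div d))\<^sup>2 - (real N / real d)\<^sup>2\<bar> \<le> 2 * (real N / real d)"
    "real N / real d < real (N div d) + 1"
proof -
  let ?x = "real N / real d" and ?y = "real (N div d)"
  show 1: "?y \<le> ?x" by (rule of_nat_div_le_of_nat)
  have "N < d * (N div d + 1)" using assms
    by (metis Suc_eq_plus1 dividend_less_times_div le_0_eq less_le_trans not_gr_zero zero_less_one mult_Suc_right add.commute)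
  then have "real N < real d * (?y + 1)" by (metis of_nat_1 of_nat_add of_nat_less_iff of_nat_mult)
  then show 2: "?x < ?y + 1" using assms by (simp add: field_simps)
  have "?x\<^sup>2 - ?y\<^sup>2 = (?x - ?y) * (?x + ?y)" by (simp add: power2_eq_square algebra_simps)
  moreover have "(?x - ?y) * (?x + ?y) \<le> 1 * (2 * ?x)" using 1 2 by (intro mult_mono) auto
  moreover have "0 \<le> (?x - ?y) * (?x + ?y)" using 1 by (intro mult_nonneg_nonneg) auto
  ultimately show "\<bar>?y\<^sup>2 - ?x\<^sup>2\<bar> \<le> 2 * ?x" by linarith
qed

section \<open>Harmonic sums, and partial sums of the L-series and of its inverse\<close>

lemma harm_eq: "(harm N :: real) = (\<Sum>d=1..N. 1 / real d)"
  by (simp add: harm_def inverse_eq_divide)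

lemma harm_ge_1: "1 \<le> N \<Longrightarrow> 1 \<le> (harm N :: real)"
  using harm_mono[of 1 N, where 'a=real] by (simp add: harm_def)

text \<open>\<open>harm n - ln n\<close> decreases from its value 1 at \<open>n = 1\<close>.\<close>

lemma harm_le_ln:
  assumes "1 \<le> N"
  shows "(harm N :: real) \<le> 1 + ln (real N)"
proof -
  have "harm (Suc n) \<le> 1 + ln (real (Suc n))" for n
    using decseqD[OF decseq_harm_diff_ln, of 0 n] by (simp add: harm_def)
  from this[of "N - 1"] show ?thesis using assms by simp
qed

definition catalan_term :: "nat \<Rightarrow> real" where
  "catalan_term n = 1 / (2 * real n + 1)\<^sup>2"

text \<open>The series alternates and its terms decrease to 0, so Leibniz's criterion encloses the
  value.\<close>

lemma L2_chi_minus4_bounds: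
  "(\<Sum>i<2*n. (-1)^i * catalan_term i) \<le> L2_chi_minus4"
  "L2_chi_minus4 \<le> (\<Sum>i<2*n+1. (-1)^i * catalan_term i)"
proof -
  have lim: "catalan_term \<longlonglongrightarrow> 0" unfolding catalan_term_def by real_asymp
  have nonneg: "0 \<le> catalan_term n" for n by (simp add: catalan_term_def)
  have mono: "catalan_term (Suc n) \<le> catalan_term n" for n
    unfolding catalan_term_def by (intro divide_left_mono power_mono) auto
  have L: "L2_chi_minus4 = (\<Sum>i. (-1)^i * catalan_term i)"
    by (simp add: L2_chi_minus4_def catalan_term_def)
  show "(\<Sum>i<2*n. (-1)^i * catalan_term i) \<le> L2_chi_minus4"
    unfolding L by (rule summable_Leibniz'(2)[OF lim nonneg mono])
  show "L2_chi_minus4 \<le> (\<Sum>i<2*n+1. (-1)^i * catalan_term i)"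
    unfolding L by (rule summable_Leibniz'(4)[OF lim nonneg mono])
qed

lemma L2_chi_minus4_partial: "\<bar>(\<Sum>i<n. (-1)^i * catalan_term i) - L2_chi_minus4\<bar> \<le> catalan_term n"
proof (cases "even n")
  case True
  then obtain k where "n = 2 * k" by (elim evenE)
  then show ?thesis using L2_chi_minus4_bounds[of k] by simp
next
  case False
  then obtain k where "n = 2 * k + 1" by (elim oddE)
  then show ?thesis using L2_chi_minus4_bounds(2)[of k] L2_chi_minus4_bounds(1)[of "Suc k"] by simp
qed

lemma L2_chi_minus4_pos: "0 < L2_chi_minus4"
  using L2_chi_minus4_bounds(1)[of 1] by (simp add: catalan_term_def numeral_2_eq_2)

lemma sum_chi_eq_catalan:
  "(\<Sum>j=1..k. real_of_int (chi (int j)) / (real j)\<^sup>2) = (\<Sum>i<(k + 1) div 2. (-1)^i * catalan_term i)"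
proof (induction k)
  case 0
  then show ?case by simp
next
  case (Suc k)
  show ?case
  proof (cases "even k")
    case True
    then obtain i where i: "k = 2 * i" by (elim evenE)
    have "real_of_int (chi (int (Suc k))) = (-1) ^ i"
    proof (cases "even i")
      case True
      then obtain j where "i = 2 * j" by (elim evenE)
      then have "int (Suc k) mod 4 = 1" unfolding i by simp
      then show ?thesis using True by (simp add: chi_def)
    next
      case False
      then obtain j where "i = 2 * j + 1" by (elim oddE)
      then have "int (Suc k) mod 4 = 3" unfolding i by simp
      then show ?thesis using False by (simp add: chi_def)
    qed
    then show ?thesis using Suc unfolding i by (simp add: catalan_term_def add.commute)
  next
    case False
    then obtain i where i: "k = 2 * i + 1" by (elim oddE)
    have "even (int (Suc k))" unfolding i by simp
    then have "chi (int (Suc k)) = 0" unfolding chi_def by presburger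
    then show ?thesis using Suc unfolding i by simp
  qed
qed

text \<open>The error is at most the first omitted term, whose denominator is the square of a number
  that is at least \<open>k + 1\<close>.\<close>

lemma sum_chi_approx:
  "\<bar>(\<Sum>j=1..k. real_of_int (chi (int j)) / (real j)\<^sup>2) - L2_chi_minus4\<bar> \<le> 1 / (real k + 1)"
proof -
  let ?K = "(k + 1) div 2"
  have "k \<le> 2 * ?K" by simp
  then have "real k \<le> 2 * real ?K" by (metis of_nat_le_iff of_nat_mult of_nat_numeral)
  then have "real k + 1 \<le> (2 * real ?K + 1) * 1" by simp
  also have "\<dots> \<le> (2 * real ?K + 1)\<^sup>2" unfolding power2_eq_square by (intro mult_left_mono) auto
  finally have "catalan_term ?K \<le> 1 / (real k + 1)"
    unfolding catalan_term_def by (intro divide_left_mono) auto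
  then show ?thesis unfolding sum_chi_eq_catalan using L2_chi_minus4_partial[of ?K] by linarith
qed

text \<open>The convolution of \<open>moebius_chi\<close> with \<open>chi\<close> is 1 at 1 and 0
  elsewhere. Dividing it by \<open>n^2\<close> and summing over \<open>n \<le> N\<close> shows that
  the sum of \<open>w d\<close> times the partial sum of length \<open>N div d\<close> of the
  L-series is exactly 1. Replacing these partial sums by \<open>L2_chi_minus4\<close> costs at most
  \<open>d / N\<close> each, weighted by \<open>1 / d^2\<close>, in total
  \<open>harm N / N\<close>.\<close>

lemma sum_moebius_chi_approx:
  assumes "1 \<le> N"
  shows "\<bar>(\<Sum>d=1..N. real_of_int (moebius_chi d) / (real d)\<^sup>2) - 1 / L2_chi_minus4\<bar> \<le> harm N / (L2_chi_minus4 * real N)"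
proof -
  define w where "w = (\<lambda>d. real_of_int (moebius_chi d) / (real d)\<^sup>2)"
  define X where "X = (\<lambda>j. real_of_int (chi (int j)) / (real j)\<^sup>2)"
  let ?L = L2_chi_minus4
  have "1 = (\<Sum>n=1..N. if n = 1 then 1 else (0::real))" using assms by (subst sum.delta) auto
  also have "\<dots> = (\<Sum>n=1..N. \<Sum>d | d dvd n. w d * X (n div d))"
  proof (rule sum.cong[OF refl])
    fix n assume "n \<in> {1..N}"
    then have n: "0 < n" by auto
    have "(\<Sum>d | d dvd n. w d * X (n div d)) = (\<Sum>d | d dvd n. real_of_int (moebius_chi d * chi (int (n div d))) / (real n)\<^sup>2)"
    proof (rule sum.cong[OF refl])
      fix d assume "d \<in> {d. d dvd n}"
      then obtain k where "n = d * k" by auto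
      then show "w d * X (n div d) = real_of_int (moebius_chi d * chi (int (n div d))) / (real n)\<^sup>2"
        using n by (simp add: w_def X_def power_mult_distrib)
    qed
    also have "\<dots> = real_of_int (dirichlet_conv moebius_chi (\<lambda>n. chi (int n)) n) / (real n)\<^sup>2"
      by (simp add: dirichlet_conv_def sum_divide_distrib)
    finally show "(if n = 1 then 1 else 0) = (\<Sum>d | d dvd n. w d * X (n div d))"
      unfolding moebius_chi_conv[OF n] by simp
  qed
  also have "\<dots> = (\<Sum>d=1..N. \<Sum>k=1..N div d. w d * X k)"
    by (rule sum_divisors_hyperbola[of "\<lambda>d k. w d * X k"])
  also have "\<dots> = (\<Sum>d=1..N. w d * (\<Sum>k=1..N div d. X k))" by (simp add: sum_distrib_left)
  finally have 1: "1 = (\<Sum>d=1..N. w d * (\<Sum>k=1..N div d. X k))" .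
  have "\<bar>1 - ?L * (\<Sum>d=1..N. w d)\<bar> = \<bar>\<Sum>d=1..N. w d * ((\<Sum>k=1..N div d. X k) - ?L)\<bar>"
    unfolding right_diff_distrib sum_subtractf 1[symmetric] sum_distrib_right[symmetric] by (simp add: mult.commute)
  also have "\<dots> \<le> (\<Sum>d=1..N. \<bar>w d * ((\<Sum>k=1..N div d. X k) - ?L)\<bar>)" by (rule sum_abs)
  also have "\<dots> \<le> (\<Sum>d=1..N. 1 / real d * (1 / real N))"
  proof (rule sum_mono)
    fix d assume d: "d \<in> {1..N}"
    have "\<bar>w d\<bar> \<le> 1 / (real d)\<^sup>2"
      unfolding w_def abs_divide using abs_moebius_chi_le[of d] by (simp add: divide_right_mono)
    moreover have "\<bar>(\<Sum>k=1..N div d. X k) - ?L\<bar> \<le> real d / real N"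
    proof -
      have "\<bar>(\<Sum>k=1..N div d. X k) - ?L\<bar> \<le> 1 / (real (N div d) + 1)"
        unfolding X_def by (rule sum_chi_approx)
      also have "\<dots> \<le> real d / real N"
        using real_div_bounds(3)[of d N] d by (simp add: field_simps)
      finally show ?thesis .
    qed
    ultimately have "\<bar>w d\<bar> * \<bar>(\<Sum>k=1..N div d. X k) - ?L\<bar> \<le> 1 / (real d)\<^sup>2 * (real d / real N)"
      by (intro mult_mono) auto
    also have "\<dots> = 1 / real d * (1 / real N)" using d by (simp add: power2_eq_square field_simps)
    finally show "\<bar>w d * ((\<Sum>k=1..N div d. X k) - ?L)\<bar> \<le> 1 / real d * (1 / real N)" by (simp add: abs_mult)
  qed
  also have "\<dots> = harm N / real N" by (simp add: harm_eq sum_divide_distrib)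
  finally have 2: "\<bar>1 - ?L * sum w {1..N}\<bar> \<le> harm N / real N" .
  have "\<bar>sum w {1..N} - 1 / ?L\<bar> = \<bar>1 - ?L * sum w {1..N}\<bar> / ?L"
    using L2_chi_minus4_pos by (simp add: abs_if field_simps)
  also have "\<dots> \<le> (harm N / real N) / ?L" using 2 L2_chi_minus4_pos by (intro divide_right_mono) auto
  finally show ?thesis by (simp add: w_def mult.commute)
qed

section \<open>The number of primitive solutions up to a bound\<close>

definition primitive_count :: "nat \<Rightarrow> nat" where
  "primitive_count N = (\<Sum>n=1..N. card (primitive_triples n))"

lemma primitive_count_eq:
  "real (primitive_count N) = 6 * (\<Sum>d=1..N. real_of_int (moebius_chi d) * (\<Sum>j=1..N div d. if odd j then real j else 0))"
proof -
  \<comment> \<open>The parity condition makes the formula valid for even \<open>n\<close> too,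
    where there are no primitive triples, so the sum can run over all \<open>n\<close>.\<close>
  let ?F = "\<lambda>d k. if odd (d * k) then 6 * (real_of_int (moebius_chi d) * real k) else 0"
  have "real (primitive_count N) = (\<Sum>n=1..N. \<Sum>d | d dvd n. ?F d (n div d))"
    unfolding primitive_count_def of_nat_sum
  proof (rule sum.cong[OF refl])
    fix n
    show "real (card (primitive_triples n)) = (\<Sum>d | d dvd n. ?F d (n div d))"
    proof (cases "even n")
      case True
      have "(\<Sum>d | d dvd n. ?F d (n div d)) = 0" by (rule sum.neutral) (use True in auto)
      then show ?thesis using primitive_triples_even[OF True] by simp
    next
      case False
      have "real (card (primitive_triples n)) = real_of_int (int (card (primitive_triples n)))" by simp
      also have "\<dots> = (\<Sum>d | d dvd n. 6 * (real_of_int (moebius_chi d) * real (n div d)))"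
        unfolding card_primitive_triples[OF False] by (simp add: sum_distrib_left)
      also have "\<dots> = (\<Sum>d | d dvd n. ?F d (n div d))"
        by (rule sum.cong) (use False in auto)
      finally show ?thesis .
    qed
  qed
  also have "\<dots> = (\<Sum>d=1..N. \<Sum>k=1..N div d. ?F d k)" by (rule sum_divisors_hyperbola)
  also have "\<dots> = (\<Sum>d=1..N. \<Sum>k=1..N div d. 6 * (real_of_int (moebius_chi d) * (if odd k then real k else 0)))"
  proof (intro sum.cong refl)
    fix d k
    \<comment> \<open>\<open>chi\<close> vanishes at even \<open>d\<close>, so only the parity of
      \<open>k\<close> remains.\<close>
    have "moebius_chi d = 0" if "even d"
    proof -
      have "even (int d)" using that by simp
      then have "chi (int d) = 0" unfolding chi_def by presburger
      then show ?thesis by (simp add: moebius_chi_def)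
    qed
    then show "?F d k = 6 * (real_of_int (moebius_chi d) * (if odd k then real k else 0))" by auto
  qed
  finally show ?thesis by (simp add: sum_distrib_left)
qed

text \<open>The coefficient of \<open>N^2\<close> in \<open>primitive_count N\<close>: 6 from the
  exact count, 1/4 from the sum of odd numbers, and the inverse L-value. It is also the coefficient
  of \<open>T^2\<close> for primitive quadruples, since the two signs of \<open>W\<close> offset
  \<open>N = T / sqrt 2\<close>.\<close>

definition prim_const :: real where
  "prim_const = 3 / (2 * L2_chi_minus4)"

lemma prim_const_pos: "0 < prim_const"
  using L2_chi_minus4_pos by (simp add: prim_const_def)

text \<open>The inner sum of odd numbers is \<open>(N / d)^2 / 4\<close> with an error
  \<open>E d\<close> of order \<open>N / d\<close>. The main terms lead to
  \<open>sum_moebius_chi_approx\<close>, and the errors add up to a multiple of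
  \<open>N * harm N\<close>; 12 is 6 times the 2 in the bound for \<open>E\<close>.\<close>

lemma primitive_count_approx:
  assumes "1 \<le> N"
  shows "\<bar>real (primitive_count N) - prim_const * (real N)\<^sup>2\<bar> \<le> (prim_const + 12) * real N * harm N"
proof -
  define w where "w = (\<lambda>d. real_of_int (moebius_chi d))"
  define E where "E = (\<lambda>d. (\<Sum>j=1..N div d. if odd j then real j else 0) - (real N / real d)\<^sup>2 / 4)"
  have w: "\<bar>w d\<bar> \<le> 1" for d using abs_moebius_chi_le[of d] by (simp add: w_def)
  \<comment> \<open>As \<open>N div d\<close> is at least 1, replacing either closed form of
    \<open>sum_odds\<close> by \<open>(N div d)^2 / 4\<close> costs at most \<open>N div d\<close>.
    Dropping the floor costs at most half of \<open>N / d\<close>.\<close>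
  have E: "\<bar>E d\<bar> \<le> 2 * (real N / real d)" if d: "d \<in> {1..N}" for d
  proof -
    let ?y = "real (N div d)"
    have "1 \<le> N div d" using d by (simp add: less_eq_div_iff_mult_less_eq)
    then have y: "1 \<le> ?y" by simp
    have "\<bar>(\<Sum>j=1..N div d. if odd j then real j else 0) - ?y\<^sup>2 / 4\<bar> \<le> ?y"
      unfolding sum_odds using y by (auto simp: power2_eq_square field_simps)
    moreover have "?y \<le> real N / real d" "\<bar>?y\<^sup>2 - (real N / real d)\<^sup>2\<bar> \<le> 2 * (real N / real d)"
      using real_div_bounds[of d N] d by auto
    ultimately show ?thesis unfolding E_def by linarith
  qed
  let ?S = "\<Sum>d=1..N. w d / (real d)\<^sup>2"
  have "real (primitive_count N) = 6 * (\<Sum>d=1..N. w d * ((real N)\<^sup>2 / 4 / (real d)\<^sup>2 + E d))"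
    unfolding primitive_count_eq E_def w_def by (simp add: power_divide)
  also have "\<dots> = 6 * ((real N)\<^sup>2 / 4 * ?S + (\<Sum>d=1..N. w d * E d))"
    unfolding distrib_left sum.distrib sum_distrib_left by (simp add: mult.assoc mult.commute)
  finally have eq: "real (primitive_count N) - prim_const * (real N)\<^sup>2
     = 3 / 2 * (real N)\<^sup>2 * (?S - 1 / L2_chi_minus4) + 6 * (\<Sum>d=1..N. w d * E d)"
    by (simp add: prim_const_def algebra_simps)
  have "\<bar>3 / 2 * (real N)\<^sup>2 * (?S - 1 / L2_chi_minus4)\<bar> = 3 / 2 * (real N)\<^sup>2 * \<bar>?S - 1 / L2_chi_minus4\<bar>"
    by (simp add: abs_mult)
  also have "\<dots> \<le> 3 / 2 * (real N)\<^sup>2 * (harm N / (L2_chi_minus4 * real N))"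
    using sum_moebius_chi_approx[OF assms] unfolding w_def by (intro mult_left_mono) auto
  also have "\<dots> = prim_const * real N * harm N"
    using assms by (simp add: prim_const_def power2_eq_square field_simps)
  finally have 1: "\<bar>3 / 2 * (real N)\<^sup>2 * (?S - 1 / L2_chi_minus4)\<bar> \<le> prim_const * real N * harm N" .
  have "\<bar>\<Sum>d=1..N. w d * E d\<bar> \<le> (\<Sum>d=1..N. \<bar>w d * E d\<bar>)" by (rule sum_abs)
  also have "\<dots> \<le> (\<Sum>d=1..N. 1 * (2 * (real N / real d)))"
    unfolding abs_mult using w E by (intro sum_mono mult_mono) auto
  also have "\<dots> = 2 * real N * harm N" by (simp add: harm_eq sum_distrib_left)
  finally have 2: "\<bar>\<Sum>d=1..N. w d * E d\<bar> \<le> 2 * real N * harm N" .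
  show ?thesis unfolding eq using 1 2 by (simp add: algebra_simps abs_le_iff)
qed

text \<open>The tail is bounded by the telescoping
  \<open>1 / (n + 1)^2 \<le> 1 / n - 1 / (n + 1)\<close>.\<close>

lemma sum_inverse_squares_approx:
  "\<bar>(\<Sum>d=1..N. 1 / (real d)\<^sup>2) - pi\<^sup>2 / 6\<bar> \<le> 1 / real N" if "1 \<le> N"
proof -
  let ?f = "\<lambda>n::nat. 1 / (real n + 1)\<^sup>2"
  have s: "?f sums (pi\<^sup>2 / 6)" using inverse_squares_sums by (simp add: add.commute)
  have eq: "(\<Sum>d=1..N. 1 / (real d)\<^sup>2) = sum ?f {..<N}" for N
    by (induction N) (auto simp: add.commute)
  have le: "sum ?f {..<N} \<le> pi\<^sup>2 / 6" using s by (metis sums_unique sum_le_suminf sums_summable finite_lessThan zero_le_divide_1_iff zero_le_power2)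
  have "sum ?f {..<N + k} \<le> sum ?f {..<N} + 1 / real N - 1 / real (N + k)" for k
  proof (induction k)
    case (Suc k)
    have "?f (N + k) \<le> 1 / real (N + k) - 1 / real (N + Suc k)"
    proof -
      define a where "a = real (N + k)"
      have a: "0 < a" using that by (simp add: a_def)
      have "1 / (a + 1)\<^sup>2 \<le> 1 / (a * (a + 1))"
        unfolding power2_eq_square using a by (intro divide_left_mono mult_right_mono mult_pos_pos) auto
      also have "\<dots> = 1 / a - 1 / (a + 1)" using a by (simp add: field_simps)
      finally show ?thesis by (simp add: a_def add.commute add.left_commute)
    qed
    then show ?case using Suc by simp
  qed simp
  then have "sum ?f {..<N + k} \<le> sum ?f {..<N} + 1 / real N" for k
    by (smt (verit) of_nat_0_le_iff zero_le_divide_1_iff)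
  moreover have "(\<lambda>k. sum ?f {..<N + k}) \<longlonglongrightarrow> pi\<^sup>2 / 6"
    using LIMSEQ_ignore_initial_segment[OF s[unfolded sums_def], of N] by (simp add: add.commute)
  ultimately have "pi\<^sup>2 / 6 \<le> sum ?f {..<N} + 1 / real N" by (intro LIMSEQ_le_const2) auto
  with le show ?thesis unfolding eq by simp
qed

section \<open>All solutions, by summation over the gcd\<close>

lemma sum_card_three_squares:
  "(\<Sum>n=1..N. card (three_squares ((int n)\<^sup>2))) = (\<Sum>g=1..N. primitive_count (N div g))"
proof -
  have "(\<Sum>n=1..N. card (three_squares ((int n)\<^sup>2))) = (\<Sum>n=1..N. \<Sum>g | g dvd n. card (primitive_triples (n div g)))"
    by (rule sum.cong) (auto intro: card_three_squares_eq_sum)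
  also have "\<dots> = (\<Sum>g=1..N. \<Sum>k=1..N div g. card (primitive_triples k))"
    by (rule sum_divisors_hyperbola)
  finally show ?thesis by (simp add: primitive_count_def)
qed

text \<open>The primitive estimate is summed at \<open>N div g\<close>. The main terms carry
  \<open>1 / g^2\<close> and give \<open>pi^2 / 6\<close>; the errors of order \<open>N / g\<close>
  give the second harmonic factor.\<close>

lemma sum_card_three_squares_approx:
  assumes "1 \<le> N"
  shows "\<bar>real (\<Sum>n=1..N. card (three_squares ((int n)\<^sup>2))) - prim_const * (pi\<^sup>2 / 6) * (real N)\<^sup>2\<bar>
     \<le> (4 * prim_const + 12) * real N * (harm N)\<^sup>2"
proof -
  let ?h = "harm N :: real"
  have h1: "1 \<le> ?h" using harm_ge_1[OF assms] .
  have h2: "?h * 1 \<le> ?h * ?h" using h1 by (intro mult_left_mono) auto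
  define E where "E = (\<lambda>g. real (primitive_count (N div g)) - prim_const * (real N / real g)\<^sup>2)"
  \<comment> \<open>\<open>prim_const + 12\<close> comes from the primitive count and
    \<open>2 * prim_const\<close> from dropping the floor. The tail of the series for
    \<open>pi^2 / 6\<close> later adds one more \<open>prim_const\<close>.\<close>
  have E: "\<bar>E g\<bar> \<le> (3 * prim_const + 12) * ?h * (real N / real g)" if g: "g \<in> {1..N}" for g
  proof -
    let ?y = "real (N div g)"
    have y: "1 \<le> N div g" using g by (simp add: less_eq_div_iff_mult_less_eq)
    have b: "?y \<le> real N / real g" "\<bar>?y\<^sup>2 - (real N / real g)\<^sup>2\<bar> \<le> 2 * (real N / real g)"
      using real_div_bounds[of g N] g by auto
    have "\<bar>real (primitive_count (N div g)) - prim_const * ?y\<^sup>2\<bar> \<le> (prim_const + 12) * ?y * harm (N div g)"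
      by (rule primitive_count_approx[OF y])
    also have "\<dots> \<le> (prim_const + 12) * (real N / real g) * ?h"
      using b(1) prim_const_pos harm_mono[of "N div g" N, where 'a=real]
      by (intro mult_mono) (auto simp: harm_nonneg)
    finally have 1: "\<bar>real (primitive_count (N div g)) - prim_const * ?y\<^sup>2\<bar> \<le> (prim_const + 12) * (real N / real g) * ?h" .
    have "\<bar>prim_const * ?y\<^sup>2 - prim_const * (real N / real g)\<^sup>2\<bar> = prim_const * \<bar>?y\<^sup>2 - (real N / real g)\<^sup>2\<bar>"
      using prim_const_pos by (simp add: abs_mult flip: right_diff_distrib)
    also have "\<dots> \<le> prim_const * (2 * (real N / real g) * ?h)"
    proof (intro mult_left_mono order.trans[OF b(2)])
      have "2 * (real N / real g) * 1 \<le> 2 * (real N / real g) * ?h" using h1 by (intro mult_left_mono) auto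
      then show "2 * (real N / real g) \<le> 2 * (real N / real g) * ?h" by simp
    qed (use prim_const_pos in auto)
    finally have 2: "\<bar>prim_const * ?y\<^sup>2 - prim_const * (real N / real g)\<^sup>2\<bar> \<le> prim_const * (2 * (real N / real g) * ?h)" .
    have "\<bar>E g\<bar> \<le> (prim_const + 12) * (real N / real g) * ?h + prim_const * (2 * (real N / real g) * ?h)"
      unfolding E_def using 1 2 by linarith
    also have "\<dots> = (3 * prim_const + 12) * ?h * (real N / real g)" by (simp add: algebra_simps)
    finally show ?thesis .
  qed
  have "\<bar>\<Sum>g=1..N. E g\<bar> \<le> (\<Sum>g=1..N. \<bar>E g\<bar>)" by (rule sum_abs)
  also have "\<dots> \<le> (\<Sum>g=1..N. (3 * prim_const + 12) * ?h * (real N / real g))" by (intro sum_mono E)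
  also have "\<dots> = (3 * prim_const + 12) * ?h * (real N * ?h)"
    unfolding sum_distrib_left[symmetric] harm_eq[of N] by (simp add: sum_distrib_left)
  finally have 1: "\<bar>\<Sum>g=1..N. E g\<bar> \<le> (3 * prim_const + 12) * real N * ?h\<^sup>2" by (simp add: power2_eq_square algebra_simps)
  let ?S = "\<Sum>g=1..N. 1 / (real g)\<^sup>2"
  have "\<bar>prim_const * (real N)\<^sup>2 * (?S - pi\<^sup>2 / 6)\<bar> = prim_const * (real N)\<^sup>2 * \<bar>?S - pi\<^sup>2 / 6\<bar>"
    using prim_const_pos by (simp add: abs_mult)
  also have "\<dots> \<le> prim_const * (real N)\<^sup>2 * (1 / real N)"
    using sum_inverse_squares_approx[OF assms] prim_const_pos by (intro mult_left_mono) auto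
  also have "\<dots> = prim_const * real N * 1" using assms by (simp add: power2_eq_square)
  also have "\<dots> \<le> prim_const * real N * ?h\<^sup>2"
    using prim_const_pos h1 h2 by (intro mult_left_mono) (auto simp: power2_eq_square)
  finally have 2: "\<bar>prim_const * (real N)\<^sup>2 * (?S - pi\<^sup>2 / 6)\<bar> \<le> prim_const * real N * ?h\<^sup>2" .
  have "real (\<Sum>n=1..N. card (three_squares ((int n)\<^sup>2))) = (\<Sum>g=1..N. prim_const * (real N)\<^sup>2 * (1 / (real g)\<^sup>2) + E g)"
    unfolding sum_card_three_squares E_def by (simp add: power_divide)
  also have "\<dots> = prim_const * (real N)\<^sup>2 * ?S + (\<Sum>g=1..N. E g)"
    unfolding sum.distrib sum_distrib_left ..
  finally have "real (\<Sum>n=1..N. card (three_squares ((int n)\<^sup>2))) - prim_const * (pi\<^sup>2 / 6) * (real N)\<^sup>2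
     = prim_const * (real N)\<^sup>2 * (?S - pi\<^sup>2 / 6) + (\<Sum>g=1..N. E g)"
    by (simp add: algebra_simps)
  then show ?thesis using 1 2 by (simp add: algebra_simps abs_le_iff)
qed

section \<open>Counting quadruples\<close>

lemma sum_int_interval_even:
  fixes f :: "int \<Rightarrow> nat"
  assumes "\<And>w. f (- w) = f w"
  shows "(\<Sum>w\<in>{- int N..int N}. f w) = f 0 + 2 * (\<Sum>n=1..N. f (int n))"
proof (induction N)
  case 0
  then show ?case by simp
next
  case (Suc N)
  have "{- int (Suc N)..int (Suc N)} = insert (int (Suc N)) (insert (- int (Suc N)) {- int N..int N})" by auto
  then have "(\<Sum>w\<in>{- int (Suc N)..int (Suc N)}. f w) = f (int (Suc N)) + (f (- int (Suc N)) + (\<Sum>w\<in>{- int N..int N}. f w))"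
    by simp
  also have "f (- int (Suc N)) = f (int (Suc N))" by (rule assms)
  finally show ?case using Suc by simp
qed

text \<open>A Lorentz quadruple has height \<open>\<bar>W\<bar> * sqrt 2\<close>, so for
  \<open>T \<ge> 0\<close> this is the largest \<open>\<bar>W\<bar>\<close> to be counted.\<close>

definition height_cutoff :: "real \<Rightarrow> nat" where
  "height_cutoff T = nat \<lfloor>T / sqrt 2\<rfloor>"

lemma lorentz_height_iff:
  assumes "0 \<le> T"
  shows "lorentz_quadruple (W, x, y, z) \<and> euclidean_height (real_quadruple (W, x, y, z)) \<le> T \<longleftrightarrow>
    \<bar>W\<bar> \<le> int (height_cutoff T) \<and> (x, y, z) \<in> three_squares (W\<^sup>2)"
proof -
  have l: "lorentz_quadruple (W, x, y, z) \<longleftrightarrow> (x, y, z) \<in> three_squares (W\<^sup>2)"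
    by (auto simp: lorentz_quadruple_def three_squares_def)
  have "euclidean_height (real_quadruple (W, x, y, z)) \<le> T \<longleftrightarrow> \<bar>W\<bar> \<le> int (height_cutoff T)"
    if t: "(x, y, z) \<in> three_squares (W\<^sup>2)"
  proof -
    have "x\<^sup>2 + y\<^sup>2 + z\<^sup>2 = W\<^sup>2" using t by (simp add: three_squares_def)
    then have "(real_of_int x)\<^sup>2 + (real_of_int y)\<^sup>2 + (real_of_int z)\<^sup>2 = (real_of_int W)\<^sup>2"
      by (metis of_int_add of_int_power)
    then have "euclidean_height (real_quadruple (W, x, y, z)) = sqrt ((real_of_int W)\<^sup>2 * 2)"
      unfolding euclidean_height_def real_quadruple_def by (simp add: add.assoc)
    also have "\<dots> = \<bar>real_of_int W\<bar> * sqrt 2" by (simp add: real_sqrt_mult)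
    finally have h: "euclidean_height (real_quadruple (W, x, y, z)) = real_of_int \<bar>W\<bar> * sqrt 2" by simp
    have "real_of_int \<bar>W\<bar> * sqrt 2 \<le> T \<longleftrightarrow> real_of_int \<bar>W\<bar> \<le> T / sqrt 2" by (simp add: field_simps)
    also have "\<dots> \<longleftrightarrow> \<bar>W\<bar> \<le> \<lfloor>T / sqrt 2\<rfloor>" by (simp only: le_floor_iff)
    also have "\<lfloor>T / sqrt 2\<rfloor> = int (height_cutoff T)" using assms by (simp add: height_cutoff_def)
    finally show ?thesis unfolding h .
  qed
  with l show ?thesis by blast
qed

text \<open>The 1 is the zero quadruple, the factor 2 the sign of \<open>W\<close>.\<close>

lemma N_L_eq:
  assumes "0 \<le> T"
  shows "N_L T = 1 + 2 * (\<Sum>n=1..height_cutoff T. card (three_squares ((int n)\<^sup>2)))"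
proof -
  let ?N = "height_cutoff T"
  have "{q. lorentz_quadruple q \<and> euclidean_height (real_quadruple q) \<le> T}
     = Sigma {- int ?N..int ?N} (\<lambda>W. three_squares (W\<^sup>2))"
  proof (rule set_eqI)
    fix q
    show "q \<in> {q. lorentz_quadruple q \<and> euclidean_height (real_quadruple q) \<le> T} \<longleftrightarrow>
      q \<in> Sigma {- int ?N..int ?N} (\<lambda>W. three_squares (W\<^sup>2))"
    proof (cases q)
      case (fields W x y z)
      then show ?thesis using lorentz_height_iff[OF assms, of W x y z] by auto
    qed
  qed
  then have "N_L T = (\<Sum>W\<in>{- int ?N..int ?N}. card (three_squares (W\<^sup>2)))"
    unfolding N_L_def by (simp add: finite_three_squares)
  also have "\<dots> = card (three_squares (0\<^sup>2)) + 2 * (\<Sum>n=1..?N. card (three_squares ((int n)\<^sup>2)))"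
    by (rule sum_int_interval_even) simp
  also have "three_squares (0\<^sup>2) = {(0, 0, 0)}"
    by (auto simp: three_squares_def add_nonneg_eq_0_iff)
  finally show ?thesis by simp
qed

lemma N_L_prim_eq:
  assumes "0 \<le> T"
  shows "N_L_prim T = 2 * primitive_count (height_cutoff T)"
proof -
  let ?N = "height_cutoff T"
  have *: "(W, x, y, z) \<in> {q. lorentz_quadruple q \<and> primitive_quadruple q \<and> euclidean_height (real_quadruple q) \<le> T} \<longleftrightarrow>
    (W, x, y, z) \<in> Sigma {- int ?N..int ?N} (\<lambda>W. primitive_triples (nat \<bar>W\<bar>))" for W x y z
    using lorentz_height_iff[OF assms, of W x y z] by (auto simp: primitive_triples_def primitive_quadruple_def abs_le_iff)
  have "{q. lorentz_quadruple q \<and> primitive_quadruple q \<and> euclidean_height (real_quadruple q) \<le> T}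
     = Sigma {- int ?N..int ?N} (\<lambda>W. primitive_triples (nat \<bar>W\<bar>))"
  proof (rule set_eqI)
    fix q
    show "q \<in> {q. lorentz_quadruple q \<and> primitive_quadruple q \<and> euclidean_height (real_quadruple q) \<le> T} \<longleftrightarrow>
      q \<in> Sigma {- int ?N..int ?N} (\<lambda>W. primitive_triples (nat \<bar>W\<bar>))"
      by (cases q) (use * in blast)
  qed
  then have "N_L_prim T = (\<Sum>W\<in>{- int ?N..int ?N}. card (primitive_triples (nat \<bar>W\<bar>)))"
    unfolding N_L_prim_def by (simp add: finite_primitive_triples)
  also have "\<dots> = card (primitive_triples (nat \<bar>0\<bar>)) + 2 * (\<Sum>n=1..?N. card (primitive_triples (nat \<bar>int n\<bar>)))"
    by (rule sum_int_interval_even) simp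
  \<comment> \<open>The only solution with \<open>W = 0\<close> is the zero quadruple, whose gcd is
    0.\<close>
  also have "primitive_triples (nat \<bar>0\<bar>) = {}" by (simp add: primitive_triples_even)
  finally show ?thesis by (simp add: primitive_count_def)
qed

section \<open>From the cutoff back to the height\<close>

lemma height_cutoff_bounds:
  assumes "2 \<le> T"
  shows "1 \<le> height_cutoff T" "real (height_cutoff T) \<le> T" "\<bar>2 * (real (height_cutoff T))\<^sup>2 - T\<^sup>2\<bar> \<le> 4 * T"
    "harm (height_cutoff T) \<le> 1 + ln T"
proof -
  let ?N = "real (height_cutoff T)" and ?x = "T / sqrt 2"
  have s: "sqrt 2 \<ge> 1" "sqrt 2 \<le> 2" using real_sqrt_le_mono[of 2 4] by auto
  then have x: "1 \<le> ?x" "?x \<le> T" using assms by (simp_all add: field_simps mult_le_cancel_left1)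
  have "0 \<le> \<lfloor>?x\<rfloor>" using x(1) by linarith
  then have N: "?N = real_of_int \<lfloor>?x\<rfloor>" by (simp add: height_cutoff_def)
  have b: "?N \<le> ?x" "?x < ?N + 1" unfolding N by linarith+
  have "1 \<le> \<lfloor>?x\<rfloor>" using x(1) by simp
  then show 1: "1 \<le> height_cutoff T" unfolding height_cutoff_def by linarith
  show 2: "?N \<le> T" using b x by linarith
  have e: "2 * ?x\<^sup>2 = T\<^sup>2" by (simp add: power_divide)
  \<comment> \<open>\<open>?x - ?N\<close> lies between 0 and 1 and \<open>?x + ?N\<close> is at
    most \<open>2 * T\<close>; doubling gives the factor 4.\<close>
  have "?x\<^sup>2 - ?N\<^sup>2 = (?x - ?N) * (?x + ?N)" by (simp add: power2_eq_square algebra_simps)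
  moreover have "(?x - ?N) * (?x + ?N) \<le> 1 * (2 * T)" using b x 2 by (intro mult_mono) auto
  moreover have "0 \<le> (?x - ?N) * (?x + ?N)" using b x by (intro mult_nonneg_nonneg) auto
  ultimately show "\<bar>2 * ?N\<^sup>2 - T\<^sup>2\<bar> \<le> 4 * T" using e by linarith
  have "harm (height_cutoff T) \<le> 1 + ln ?N" using harm_le_ln[OF 1] .
  also have "\<dots> \<le> 1 + ln T" using 1 2 assms by simp
  finally show "harm (height_cutoff T) \<le> 1 + ln T" .
qed

text \<open>From \<open>T = 3\<close> on, \<open>ln T \<ge> 1\<close>. So the harmonic sum is at
  most \<open>1 + ln T \<le> 2 * ln T\<close>, whose square gives the factor 4, and the linear error
  is absorbed.\<close>

lemma bigo_from_cutoff_bound: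
  fixes f :: "real \<Rightarrow> real"
  assumes "0 \<le> C" "0 \<le> D" and f: "\<And>T. 3 \<le> T \<Longrightarrow> \<bar>f T\<bar> \<le> C * (real (height_cutoff T) * (harm (height_cutoff T))\<^sup>2) + D * T"
  shows "f \<in> O[at_top](\<lambda>T. T * (ln T)\<^sup>2)"
proof (rule bigoI)
  show "eventually (\<lambda>T. norm (f T) \<le> (4 * C + D) * norm (T * (ln T)\<^sup>2)) at_top"
  proof (rule eventually_mono[OF eventually_ge_at_top[of 3]])
    fix T :: real assume T: "3 \<le> T"
    let ?N = "height_cutoff T"
    have "exp 1 \<le> T" using exp_le T by linarith
    then have l: "1 \<le> ln T" using T by (subst ln_ge_iff) auto
    have "harm ?N \<le> 2 * ln T" using height_cutoff_bounds(4)[of T] T l by linarith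
    then have "(harm ?N)\<^sup>2 \<le> (2 * ln T)\<^sup>2" by (intro power_mono) (auto simp: harm_nonneg)
    then have "real ?N * (harm ?N)\<^sup>2 \<le> T * (2 * ln T)\<^sup>2"
      using height_cutoff_bounds(2)[of T] T by (intro mult_mono) auto
    then have 1: "C * (real ?N * (harm ?N)\<^sup>2) \<le> C * (T * (2 * ln T)\<^sup>2)" using assms(1) by (intro mult_left_mono)
    have "1 * 1 \<le> ln T * ln T" using l by (intro mult_mono) auto
    then have "T * 1 \<le> T * (ln T)\<^sup>2" using T by (intro mult_left_mono) (auto simp: power2_eq_square)
    then have 2: "D * T \<le> D * (T * (ln T)\<^sup>2)" using assms(2) by (intro mult_left_mono) auto
    have "\<bar>f T\<bar> \<le> (4 * C + D) * (T * (ln T)\<^sup>2)"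
      using f[OF T] 1 2 by (simp add: power_mult_distrib algebra_simps)
    then show "norm (f T) \<le> (4 * C + D) * norm (T * (ln T)\<^sup>2)" using T by (simp add: abs_mult)
  qed
qed

lemma main_term_shift:
  assumes "2 \<le> T" "0 \<le> c"
  shows "\<bar>2 * (c * (real (height_cutoff T))\<^sup>2) - c * T\<^sup>2\<bar> \<le> c * (4 * T)"
proof -
  have eq: "2 * (c * (real (height_cutoff T))\<^sup>2) - c * T\<^sup>2 = c * (2 * (real (height_cutoff T))\<^sup>2 - T\<^sup>2)"
    by (simp add: algebra_simps)
  have "\<bar>2 * (c * (real (height_cutoff T))\<^sup>2) - c * T\<^sup>2\<bar> = c * \<bar>2 * (real (height_cutoff T))\<^sup>2 - T\<^sup>2\<bar>"
    unfolding eq using assms(2) by (simp add: abs_mult)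
  also have "\<dots> \<le> c * (4 * T)" using height_cutoff_bounds(3)[OF assms(1)] assms(2) by (rule mult_left_mono)
  finally show ?thesis .
qed

lemma N_L_asymptotics:
  "(\<lambda>T. real (N_L T) - pi\<^sup>2 / (4 * L2_chi_minus4) * T\<^sup>2) \<in> O[at_top](\<lambda>T. T * (ln T)\<^sup>2)"
proof -
  define c where "c = prim_const * (pi\<^sup>2 / 6)"
  have c: "0 \<le> c" using prim_const_pos by (simp add: c_def)
  \<comment> \<open>The factor \<open>pi^2 / 6\<close> turns 3/2 into
    \<open>pi^2 / 4\<close>.\<close>
  have eq: "pi\<^sup>2 / (4 * L2_chi_minus4) = c" by (simp add: c_def prim_const_def)
  show ?thesis unfolding eq
  \<comment> \<open>The 1 absorbs the zero quadruple, and \<open>4 * c\<close> the replacement of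
    \<open>2 * N^2\<close> by \<open>T^2\<close>.\<close>
  proof (rule bigo_from_cutoff_bound[of "2 * (4 * prim_const + 12)" "1 + 4 * c"])
    fix T :: real assume T: "3 \<le> T"
    let ?N = "height_cutoff T"
    let ?S = "real (\<Sum>n=1..?N. card (three_squares ((int n)\<^sup>2)))"
    have "\<bar>?S - c * (real ?N)\<^sup>2\<bar> \<le> (4 * prim_const + 12) * real ?N * (harm ?N)\<^sup>2"
      unfolding c_def using height_cutoff_bounds(1)[of T] T by (intro sum_card_three_squares_approx) auto
    moreover have "real (N_L T) = 1 + 2 * ?S" using N_L_eq[of T] T by simp
    moreover have "\<bar>2 * (c * (real ?N)\<^sup>2) - c * T\<^sup>2\<bar> \<le> c * (4 * T)" using T c by (intro main_term_shift) auto
    ultimately have "\<bar>real (N_L T) - c * T\<^sup>2\<bar> \<le> 1 + 2 * ((4 * prim_const + 12) * real ?N * (harm ?N)\<^sup>2) + c * (4 * T)"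
      by linarith
    also have "\<dots> \<le> 2 * (4 * prim_const + 12) * (real ?N * (harm ?N)\<^sup>2) + (1 + 4 * c) * T"
      using T by (simp add: algebra_simps)
    finally show "\<bar>real (N_L T) - c * T\<^sup>2\<bar> \<le> 2 * (4 * prim_const + 12) * (real ?N * (harm ?N)\<^sup>2) + (1 + 4 * c) * T" .
  qed (use c prim_const_pos in auto)
qed

lemma N_L_prim_asymptotics:
  "(\<lambda>T. real (N_L_prim T) - 3 / (2 * L2_chi_minus4) * T\<^sup>2) \<in> O[at_top](\<lambda>T. T * (ln T)\<^sup>2)"
  unfolding prim_const_def[symmetric]
proof (rule bigo_from_cutoff_bound[of "2 * (prim_const + 12)" "4 * prim_const"])
  fix T :: real assume T: "3 \<le> T"
  let ?N = "height_cutoff T"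
  have N: "1 \<le> ?N" using height_cutoff_bounds(1)[of T] T by simp
  \<comment> \<open>As \<open>harm ?N \<ge> 1\<close>, an error with one harmonic factor fits the
    squared form of \<open>bigo_from_cutoff_bound\<close>.\<close>
  have h: "harm ?N * 1 \<le> harm ?N * (harm ?N :: real)" using harm_ge_1[OF N] by (intro mult_left_mono) auto
  have "\<bar>real (primitive_count ?N) - prim_const * (real ?N)\<^sup>2\<bar> \<le> (prim_const + 12) * real ?N * harm ?N"
    by (rule primitive_count_approx[OF N])
  also have "\<dots> \<le> (prim_const + 12) * real ?N * (harm ?N)\<^sup>2"
    using h prim_const_pos by (intro mult_left_mono) (auto simp: power2_eq_square)
  finally have "\<bar>real (primitive_count ?N) - prim_const * (real ?N)\<^sup>2\<bar> \<le> (prim_const + 12) * real ?N * (harm ?N)\<^sup>2" .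
  moreover have "real (N_L_prim T) = 2 * real (primitive_count ?N)" using N_L_prim_eq[of T] T by simp
  moreover have "\<bar>2 * (prim_const * (real ?N)\<^sup>2) - prim_const * T\<^sup>2\<bar> \<le> prim_const * (4 * T)"
    using T prim_const_pos by (intro main_term_shift) auto
  ultimately have "\<bar>real (N_L_prim T) - prim_const * T\<^sup>2\<bar> \<le> 2 * ((prim_const + 12) * real ?N * (harm ?N)\<^sup>2) + prim_const * (4 * T)"
    by linarith
  then show "\<bar>real (N_L_prim T) - prim_const * T\<^sup>2\<bar> \<le> 2 * (prim_const + 12) * (real ?N * (harm ?N)\<^sup>2) + 4 * prim_const * T"
    by (simp add: algebra_simps)
qed (use prim_const_pos in auto)

section \<open>The duality between Descartes and Lorentz quadruples\<close>

text \<open>The isometry of order two that exchanges the Descartes and the Lorentz form; the second to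
  fourth entries are \<open>(a + b - c - d) / 2\<close> and so on.\<close>

definition descartes_lorentz :: "quadruple \<Rightarrow> quadruple" where
  "descartes_lorentz = (\<lambda>(a, b, c, d). let W = (a + b + c + d) div 2 in (W, a + b - W, a + c - W, a + d - W))"

text \<open>The Descartes equation makes the square of the sum even; the Lorentz equation, read
  modulo 2, makes the sum even. So the halving in \<open>descartes_lorentz\<close> is exact.\<close>

lemma descartes_lorentz_even:
  assumes "descartes_quadruple (a, b, c, d) \<or> lorentz_quadruple (a, b, c, d)"
  shows "a + b + c + d = 2 * ((a + b + c + d) div 2)"
proof -
  have "even (a + b + c + d)" using assms
  proof
    assume "descartes_quadruple (a, b, c, d)"
    then have "2 * (a\<^sup>2 + b\<^sup>2 + c\<^sup>2 + d\<^sup>2) = (a + b + c + d)\<^sup>2" by (simp add: descartes_quadruple_def)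
    then have "even ((a + b + c + d)\<^sup>2)" by (metis dvd_triv_left)
    then show ?thesis by simp
  next
    assume "lorentz_quadruple (a, b, c, d)"
    then have "a\<^sup>2 = b\<^sup>2 + c\<^sup>2 + d\<^sup>2" by (simp add: lorentz_quadruple_def)
    then have "even (a\<^sup>2) = even (b\<^sup>2 + c\<^sup>2 + d\<^sup>2)" by simp
    then show ?thesis by (cases "even b"; cases "even c"; cases "even d") simp_all
  qed
  then show ?thesis by simp
qed

text \<open>Eliminating \<open>a\<close> through the half sum \<open>W\<close> removes the division
  and turns the claims below into polynomial identities.\<close>

lemma descartes_lorentz_eq:
  assumes "descartes_quadruple (a, b, c, d) \<or> lorentz_quadruple (a, b, c, d)"
  obtains W where "a = 2 * W - b - c - d" "descartes_lorentz (a, b, c, d) = (W, a + b - W, a + c - W, a + d - W)"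
proof (rule that)
  show "a = 2 * ((a + b + c + d) div 2) - b - c - d" using descartes_lorentz_even[OF assms] by linarith
qed (simp add: descartes_lorentz_def Let_def)

lemma descartes_lorentz_swap:
  "descartes_quadruple q \<Longrightarrow> lorentz_quadruple (descartes_lorentz q)"
  "lorentz_quadruple q \<Longrightarrow> descartes_quadruple (descartes_lorentz q)"
proof -
  obtain a b c d where q: "q = (a, b, c, d)" by (cases q)
  show "lorentz_quadruple (descartes_lorentz q)" if h: "descartes_quadruple q"
  proof -
    from h obtain W where W: "a = 2 * W - b - c - d" "descartes_lorentz q = (W, a + b - W, a + c - W, a + d - W)"
      unfolding q by (metis descartes_lorentz_eq)
    show ?thesis using h unfolding W(2) unfolding q W(1)
      by (simp add: descartes_quadruple_def lorentz_quadruple_def power2_eq_square algebra_simps)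
  qed
  show "descartes_quadruple (descartes_lorentz q)" if h: "lorentz_quadruple q"
  proof -
    from h obtain W where W: "a = 2 * W - b - c - d" "descartes_lorentz q = (W, a + b - W, a + c - W, a + d - W)"
      unfolding q by (metis descartes_lorentz_eq)
    show ?thesis using h unfolding W(2) unfolding q W(1)
      by (simp add: descartes_quadruple_def lorentz_quadruple_def power2_eq_square algebra_simps)
  qed
qed

lemma descartes_lorentz_involution:
  assumes "descartes_quadruple q \<or> lorentz_quadruple q"
  shows "descartes_lorentz (descartes_lorentz q) = q"
    "euclidean_height (real_quadruple (descartes_lorentz q)) = euclidean_height (real_quadruple q)"
proof -
  obtain a b c d where q: "q = (a, b, c, d)" by (cases q)
  from assms obtain W where W: "a = 2 * W - b - c - d" "descartes_lorentz q = (W, a + b - W, a + c - W, a + d - W)"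
    unfolding q by (metis descartes_lorentz_eq)
  \<comment> \<open>The entries of the image add up to \<open>2 * a\<close>, so the second half sum
    is \<open>a\<close> again.\<close>
  have "(W + (a + b - W) + (a + c - W) + (a + d - W)) div 2 = a" unfolding W(1) by simp
  then show "descartes_lorentz (descartes_lorentz q) = q"
    unfolding W(2) unfolding descartes_lorentz_def q by (simp add: Let_def)
  show "euclidean_height (real_quadruple (descartes_lorentz q)) = euclidean_height (real_quadruple q)"
    unfolding W(2) unfolding q W(1) euclidean_height_def real_quadruple_def
    by (simp add: power2_eq_square algebra_simps)
qed

text \<open>A common divisor \<open>h\<close> divides \<open>2 * W\<close>, which for even
  \<open>h\<close> falls short of dividing \<open>W\<close>. For nonzero \<open>h\<close> the
  quotient by \<open>h\<close> is again a Descartes or Lorentz quadruple, so its entries have an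
  even sum, and this supplies the factor 2.\<close>

lemma descartes_lorentz_dvd:
  assumes q: "descartes_quadruple (a, b, c, d) \<or> lorentz_quadruple (a, b, c, d)"
    and h: "h dvd a" "h dvd b" "h dvd c" "h dvd d"
    and e: "descartes_lorentz (a, b, c, d) = (W, X, Y, Z)"
  shows "h dvd W" "h dvd X" "h dvd Y" "h dvd Z"
proof -
  have s: "a + b + c + d = 2 * W" "X = a + b - W" "Y = a + c - W" "Z = a + d - W"
    using descartes_lorentz_even[OF q] e by (auto simp: descartes_lorentz_def Let_def)
  obtain a' b' c' d' where h': "a = h * a'" "b = h * b'" "c = h * c'" "d = h * d'" using h by (auto elim!: dvdE)
  show W: "h dvd W"
  proof (cases "h = 0")
    case True
    then show ?thesis using s(1) h' by simp
  next
    case False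
    have "descartes_quadruple (a', b', c', d') \<or> lorentz_quadruple (a', b', c', d')"
      using q
    proof
      assume "descartes_quadruple (a, b, c, d)"
      then have "h\<^sup>2 * (2 * (a'\<^sup>2 + b'\<^sup>2 + c'\<^sup>2 + d'\<^sup>2)) = h\<^sup>2 * (a' + b' + c' + d')\<^sup>2"
        unfolding h' by (simp add: descartes_quadruple_def algebra_simps power2_eq_square)
      then show ?thesis using False by (simp add: descartes_quadruple_def)
    next
      assume "lorentz_quadruple (a, b, c, d)"
      then have "h\<^sup>2 * (b'\<^sup>2 + c'\<^sup>2 + d'\<^sup>2) = h\<^sup>2 * a'\<^sup>2"
        unfolding h' by (simp add: lorentz_quadruple_def algebra_simps power2_eq_square)
      then show ?thesis using False by (simp add: lorentz_quadruple_def)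
    qed
    from descartes_lorentz_even[OF this] obtain V where "a' + b' + c' + d' = 2 * V" by blast
    then have "2 * W = h * (2 * V)" using s(1) unfolding h' by (simp flip: distrib_left)
    then have "W = h * V" by simp
    then show ?thesis by simp
  qed
  show "h dvd X" "h dvd Y" "h dvd Z" unfolding s using W h by auto
qed

text \<open>The map is an involution that preserves common divisors, so the gcd \<open>h\<close> of
  the image divides the entries of \<open>q\<close>.\<close>

lemma descartes_lorentz_primitive:
  assumes q: "descartes_quadruple q \<or> lorentz_quadruple q" and p: "primitive_quadruple q"
  shows "primitive_quadruple (descartes_lorentz q)"
proof -
  obtain a b c d where e: "q = (a, b, c, d)" by (cases q)
  obtain W X Y Z where f: "descartes_lorentz q = (W, X, Y, Z)" by (cases "descartes_lorentz q")
  define h where "h = Gcd {W, X, Y, Z}"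
  have h: "h dvd W" "h dvd X" "h dvd Y" "h dvd Z" unfolding h_def by (rule Gcd_dvd; simp)+
  have "descartes_quadruple (W, X, Y, Z) \<or> lorentz_quadruple (W, X, Y, Z)"
    using q descartes_lorentz_swap[of q] unfolding f by blast
  moreover have "descartes_lorentz (W, X, Y, Z) = (a, b, c, d)"
    unfolding f[symmetric] e[symmetric] by (rule descartes_lorentz_involution(1)[OF q])
  ultimately have "h dvd a" "h dvd b" "h dvd c" "h dvd d"
    by (rule descartes_lorentz_dvd[OF _ h])+
  then have "h dvd gcd a (gcd b (gcd c d))" by (intro gcd_greatest)
  moreover have "gcd a (gcd b (gcd c d)) = 1" using p by (simp add: e primitive_quadruple_def)
  ultimately have "h dvd 1" by (simp only:)
  then have "\<bar>h\<bar> = 1" by simp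
  moreover have "0 \<le> h" by (simp add: h_def)
  ultimately have "h = 1" by linarith
  then show ?thesis by (simp add: f primitive_quadruple_def h_def)
qed

lemma N_D_eq_N_L: "N_D T = N_L T"
  unfolding N_D_def N_L_def
  by (rule bij_betw_same_card[of descartes_lorentz], rule bij_betw_byWitness[where f'=descartes_lorentz])
    (auto simp: descartes_lorentz_involution descartes_lorentz_swap)

lemma N_D_prim_eq_N_L_prim: "N_D_prim T = N_L_prim T"
  unfolding N_D_prim_def N_L_prim_def
  by (rule bij_betw_same_card[of descartes_lorentz], rule bij_betw_byWitness[where f'=descartes_lorentz])
    (auto simp: descartes_lorentz_involution descartes_lorentz_swap descartes_lorentz_primitive)

theorem theorem2p2:
  shows "(\<forall>T::real. N_D T = N_L T) \<and>
    (\<lambda>T::real. real (N_L T) - pi^2 / (4 * L2_chi_minus4) * T^2) \<in> O[at_top](\<lambda>T. T * (ln T)^2) \<and>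
    (\<forall>T::real. N_D_prim T = N_L_prim T) \<and>
    (\<lambda>T::real. real (N_L_prim T) - 3 / (2 * L2_chi_minus4) * T^2) \<in> O[at_top](\<lambda>T. T * (ln T)^2)"
  using N_D_eq_N_L N_D_prim_eq_N_L_prim N_L_asymptotics N_L_prim_asymptotics by blast

end
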